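(* Let $H_{\mathrm d}$ and $H^+$ be the operators of convolution on $\mathbb{Z}$ with the kernels $$K_{\mathrm d}(n)=\frac1\pi\int_0^\pi\rho(\theta)^{1/2}\sin\bigl((n+\tfrac12)\theta\bigr)\,d\theta,\qquad K_{H^+}(n)=\frac{1}{\pi(n+\frac12)},$$ where $\rho(\theta)=2-\cos\theta-\sqrt{(2-\cos\theta)^2-1}$, and let $D=K_{\mathrm d}-K_{H^+}$. Then for every $1<p<\infty$ and every $a\in\ell^p(\mathbb{Z})$, $$\|H_{\mathrm d}a\|_{\ell^p}\le\|H^+a\|_{\ell^p}+\|D\|_{\ell^1}\|a\|_{\ell^p}.$$ In addition, there is a constant $C<\infty$ such that for every $a\in\ell^1(\mathbb{Z})$ and every $\lambda>0$, $$\#\{n\in\mathbb{Z}:|H_{\mathrm d}a(n)|>\lambda\}\le\frac{C\,\|a\|_{\ell^1}}{\lambda}+\frac{\|D\|_{\ell^1}\|a\|_{\ell^1}}{\lambda}.$$ Consequently $H_{\mathrm d}$ is of weak type $(1,1)$ and is bounded on $\ell^p(\mathbb{Z})$ for $1<p<\infty$.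
   Context: For a kernel $K$ and a sequence $a$ on $\mathbb{Z}$, $(K*a)(n)=\sum_{m\in\mathbb{Z}}K(n-m)a_m$. $H_{\mathrm d}$ is the discrete Hilbert transform with Fourier multiplier $(-\mathrm{i}\,\operatorname{sgn}\theta)\rho(\theta)^{1/2}e^{\mathrm{i}\theta/2}$; $H^+$ is the Riesz--Titchmarsh transform, with Fourier multiplier $(-\mathrm{i}\,\operatorname{sgn}\theta)e^{\mathrm{i}\theta/2}$. It is a known fact that $H^+$ is bounded on $\ell^p(\mathbb{Z})$ for $1<p<\infty$ and is of weak type $(1,1)$. Here $\rho(\theta)$ is the root in $(0,1]$ of $\rho+\rho^{-1}=4-2\cos\theta$. $\#$ denotes cardinality. *)

theory Defs
  imports "HOL-Analysis.Analysis"
begin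

definition ell :: "real \<Rightarrow> (int \<Rightarrow> 'a::real_normed_vector) set" where
  "ell p = {a. (\<lambda>n. norm (a n) powr p) summable_on UNIV}"

text \<open>The norm is only meaningful on \<open>ell p\<close>: \<open>infsum\<close> is 0 if the family is not summable.\<close>

definition ell_norm :: "real \<Rightarrow> (int \<Rightarrow> 'a::real_normed_vector) \<Rightarrow> real" where
  "ell_norm p a = (\<Sum>\<^sub>\<infinity>n. norm (a n) powr p) powr (1 / p)"

text \<open>Sequences are complex-valued, kernels are real. For complex families, unconditional
  summability (\<open>summable_on\<close>) is the same as absolute convergence of the series.\<close>

definition convolvable :: "(int \<Rightarrow> real) \<Rightarrow> (int \<Rightarrow> complex) \<Rightarrow> bool" where
  "convolvable K a \<longleftrightarrow> (\<forall>n. (\<lambda>m. complex_of_real (K (n - m)) * a m) summable_on UNIV)"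

definition conv :: "(int \<Rightarrow> real) \<Rightarrow> (int \<Rightarrow> complex) \<Rightarrow> int \<Rightarrow> complex" where
  "conv K a n = (\<Sum>\<^sub>\<infinity>m. complex_of_real (K (n - m)) * a m)"

definition bounded_on_ell :: "real \<Rightarrow> ((int \<Rightarrow> complex) \<Rightarrow> int \<Rightarrow> complex) \<Rightarrow> bool" where
  "bounded_on_ell p T \<longleftrightarrow>
     (\<exists>C::real. \<forall>a \<in> ell p. T a \<in> ell p \<and> ell_norm p (T a) \<le> C * ell_norm p a)"

text \<open>Finiteness is required separately because \<open>card\<close> of an infinite set is 0.\<close>

definition weak_type_1_1 :: "((int \<Rightarrow> complex) \<Rightarrow> int \<Rightarrow> complex) \<Rightarrow> bool" where
  "weak_type_1_1 T \<longleftrightarrow>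
     (\<exists>C::real. \<forall>a \<in> ell 1. \<forall>t>0.
        finite {n. cmod (T a n) > t} \<and>
        real (card {n. cmod (T a n) > t}) \<le> C * ell_norm 1 a / t)"

definition rho :: "real \<Rightarrow> real" where
  "rho \<theta> = 2 - cos \<theta> - sqrt ((2 - cos \<theta>)\<^sup>2 - 1)"

definition K_d :: "int \<Rightarrow> real" where
  "K_d n = 1 / pi *
     integral {0..pi} (\<lambda>\<theta>. sqrt (rho \<theta>) * sin ((real_of_int n + 1 / 2) * \<theta>))"

definition K_Hplus :: "int \<Rightarrow> real" where
  "K_Hplus n = 1 / (pi * (real_of_int n + 1 / 2))"

definition D :: "int \<Rightarrow> real" where
  "D n = K_d n - K_Hplus n"

definition H_d :: "(int \<Rightarrow> complex) \<Rightarrow> int \<Rightarrow> complex" where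
  "H_d = conv K_d"

definition H_plus :: "(int \<Rightarrow> complex) \<Rightarrow> int \<Rightarrow> complex" where
  "H_plus = conv K_Hplus"

end

theory Submission
  imports Defs
begin

text \<open>
  Two integrations by parts give \<open>D n = O(n\<^sup>-\<^sup>2)\<close>, so \<open>D\<close> is summable and everything reduces to the
  Riesz--Titchmarsh transform, that is to finite sums with the kernel \<open>1 / (n + 1/2)\<close>.

  Weak type (1,1) is a discrete form of Boole's identity. For a finite set \<open>S\<close> of integers the
  product of the factors \<open>1 \<plusminus> (1/2) / (y - n)\<close>, \<open>n \<in> S\<close>, is nonnegative at all half-integers \<open>y\<close>,
  and its partial fraction expansion has residues of one sign with total mass \<open>card S / 2\<close>. These
  residues are a test sequence: pairing it with \<open>H a\<close> for \<open>a \<ge> 0\<close> bounds the size of a level set \<open>S\<close>.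

  The kernel satisfies an exact Cotlar identity, which gives boundedness on \<open>\<ell>\<^sup>2\<close> and then by
  doubling on \<open>\<ell>\<^sup>p\<close> for \<open>p = 2, 4, 8, \<dots>\<close>. Marcinkiewicz interpolation between weak type (1,1) and
  these exponents covers all \<open>1 < p < \<infinity>\<close>, so no duality is needed.
\<close>


subsection \<open>Weak type (1,1) for finite sums\<close>

text \<open>This is \<open>pi * K_Hplus n\<close>. The factor \<open>pi\<close> is kept out of the
  algebra with partial fractions and returns in \<open>K_Hplus_eq\<close>.\<close>

definition cauchy_kernel :: "int \<Rightarrow> real" where
  "cauchy_kernel n = 1 / (real_of_int n + 1 / 2)"

text \<open>Truncation is carried by the finite set \<open>F\<close>, not by the sequence: splitting
  a sequence into large and small entries is then just splitting \<open>F\<close>.\<close>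

definition fconv :: "(int \<Rightarrow> real) \<Rightarrow> int set \<Rightarrow> (int \<Rightarrow> real) \<Rightarrow> int \<Rightarrow> real" where
  "fconv K F a n = (\<Sum>m\<in>F. K (n - m) * a m)"

lemma half_shift_neq_0: "real_of_int n + 1/2 \<noteq> 0"
proof
  assume "real_of_int n + 1/2 = 0"
  then have "real_of_int (2 * n + 1) = of_int 0" by simp
  then have "2 * n + 1 = 0" by linarith
  then show False by presburger
qed

text \<open>The product has simple poles at the points of \<open>S\<close>. Its residue at
  \<open>n\<close> is \<open>e\<close> times the product of the other factors at \<open>n\<close>,
  and these are nonnegative because distinct integers are at distance at least 1 and
  \<open>\<bar>e\<bar> \<le> 1\<close>. The total mass is the coefficient of \<open>1 / y\<close> at
  infinity. The proof adds one pole at a time.\<close>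

lemma partial_fraction_weights:
  fixes S :: "int set" and e :: real
  assumes "finite S" "\<bar>e\<bar> \<le> 1"
  shows "\<exists>c::int \<Rightarrow> real. (\<forall>n\<in>S. 0 \<le> c n) \<and> sum c S = card S \<and>
    (\<forall>y::real. y \<notin> of_int ` S \<longrightarrow>
      (\<Prod>n\<in>S. 1 + e / (y - of_int n)) = 1 + e * (\<Sum>n\<in>S. c n / (y - of_int n)))"
  using assms(1)
proof (induction S rule: finite_linorder_max_induct)
  case empty
  then show ?case by auto
next
  case (insert s S)
  have sS: "s \<notin> S" and fin: "finite S" using insert by auto
  from insert.IH obtain c :: "int \<Rightarrow> real" where c: "\<forall>n\<in>S. 0 \<le> c n" "sum c S = card S"
    and prod: "\<And>y::real. y \<notin> of_int ` S \<Longrightarrow>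
      (\<Prod>n\<in>S. 1 + e / (y - of_int n)) = 1 + e * (\<Sum>n\<in>S. c n / (y - of_int n))" by auto
  have fac: "0 \<le> 1 + e / (real_of_int i - real_of_int j)" if "i \<noteq> j" for i j :: int
  proof -
    have "\<bar>real_of_int i - real_of_int j\<bar> \<ge> 1" using that by linarith
    then have "\<bar>e / (real_of_int i - real_of_int j)\<bar> \<le> 1"
      using assms(2) by (simp add: abs_divide divide_le_eq_1)
    then show ?thesis by linarith
  qed
  \<comment> \<open>The weight of the new pole is the old product evaluated at \<open>s\<close>,
    written in expanded form; each old weight is multiplied by the value of the new factor at its
    pole.\<close>
  define c' where "c' n = (if n = s then 1 + e * (\<Sum>n\<in>S. c n / (s - of_int n))
                           else c n * (1 + e / (of_int n - of_int s)))" for n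
  have c's: "c' s = (\<Prod>n\<in>S. 1 + e / (real_of_int s - of_int n))"
  proof -
    have "real_of_int s \<notin> of_int ` S" using sS by auto
    then show ?thesis using prod by (simp add: c'_def)
  qed
  have c'S: "c' n = c n * (1 + e / (of_int n - of_int s))" if "n \<in> S" for n
    using that sS by (auto simp: c'_def)
  have nn: "\<forall>n\<in>insert s S. 0 \<le> c' n"
  proof -
    have "0 \<le> c' s" unfolding c's using fac sS by (intro prod_nonneg) metis
    moreover have "0 \<le> c' n" if "n \<in> S" for n
      unfolding c'S[OF that] using c(1) fac[of n s] that sS by (intro mult_nonneg_nonneg) auto
    ultimately show ?thesis by blast
  qed
  have e_swap: "e * (\<Sum>n\<in>S. c n / (s - of_int n)) = - (\<Sum>n\<in>S. c n * (e / (of_int n - of_int s)))"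
  proof -
    have "e * (c n / (of_int s - of_int n)) = - (c n * (e / (of_int n - of_int s)))" if "n \<in> S" for n
    proof -
      have "real_of_int n - of_int s \<noteq> 0" "real_of_int s - of_int n \<noteq> 0" using sS that by auto
      then show ?thesis by (simp add: divide_simps) (simp add: algebra_simps)
    qed
    then show ?thesis by (simp add: sum_distrib_left flip: sum_negf)
  qed
  \<comment> \<open>What the old weights gain in total is what the new weight falls short of 1, so
    the mass grows by exactly 1.\<close>
  have sumc: "sum c' (insert s S) = card (insert s S)"
  proof -
    have "sum c' S = sum c S + (\<Sum>n\<in>S. c n * (e / (of_int n - of_int s)))"
      unfolding sum.distrib[symmetric] by (intro sum.cong refl) (simp only: c'S distrib_left mult_1_right)
    moreover have "c' s = 1 - (\<Sum>n\<in>S. c n * (e / (of_int n - of_int s)))"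
      unfolding c'_def e_swap by simp
    ultimately show ?thesis using sS fin c(2) by simp
  qed
  have "(\<Prod>n\<in>insert s S. 1 + e / (y - of_int n)) = 1 + e * (\<Sum>n\<in>insert s S. c' n / (y - of_int n))"
    if y: "y \<notin> of_int ` insert s S" for y :: real
  proof -
    have ys: "y \<noteq> of_int s" and yS: "y \<notin> of_int ` S" using y by auto
    \<comment> \<open>Partial fractions of \<open>1 / ((y - n) (y - s))\<close>; the two resulting
      terms go to the old pole \<open>n\<close> and to the new pole \<open>s\<close>.\<close>
    have split: "c n / (y - of_int n) * (e / (y - of_int s)) =
          c n * (e / (of_int n - of_int s)) * (1 / (y - of_int n) - 1 / (y - of_int s))"
      if n: "n \<in> S" for n
    proof -
      have "real_of_int n - of_int s \<noteq> 0" "y - of_int n \<noteq> 0" "y - of_int s \<noteq> 0"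
        using n sS ys yS by auto
      then show ?thesis by (simp add: divide_simps)
    qed
    have "(\<Prod>n\<in>insert s S. 1 + e / (y - of_int n))
        = (1 + e * (\<Sum>n\<in>S. c n / (y - of_int n))) * (1 + e / (y - of_int s))"
      using sS fin prod[OF yS] by (simp add: mult.commute)
    also have "\<dots> = 1 + e * (\<Sum>n\<in>S. c n / (y - of_int n)) + e / (y - of_int s)
        + e * (\<Sum>n\<in>S. c n / (y - of_int n) * (e / (y - of_int s)))"
      unfolding sum_distrib_right[symmetric] by (simp only: distrib_left distrib_right mult_1_left mult_1_right mult.assoc add_ac)
    also have "(\<Sum>n\<in>S. c n / (y - of_int n) * (e / (y - of_int s)))
        = (\<Sum>n\<in>S. c n * (e / (of_int n - of_int s)) / (y - of_int n))
          - (\<Sum>n\<in>S. c n * (e / (of_int n - of_int s))) / (y - of_int s)"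
      by (rule trans[OF sum.cong[OF refl split]], assumption)
         (simp add: sum_subtractf sum_divide_distrib right_diff_distrib)
    also have "1 + e * (\<Sum>n\<in>S. c n / (y - of_int n)) + e / (y - of_int s) + e * \<dots>
        = 1 + e * ((\<Sum>n\<in>S. c n / (y - of_int n))
            + (\<Sum>n\<in>S. c n * (e / (of_int n - of_int s)) / (y - of_int n))
            + (1 - (\<Sum>n\<in>S. c n * (e / (of_int n - of_int s)))) / (y - of_int s))"
      by (simp add: algebra_simps diff_divide_distrib)
    also have "(\<Sum>n\<in>S. c n / (y - of_int n))
            + (\<Sum>n\<in>S. c n * (e / (of_int n - of_int s)) / (y - of_int n))
        = (\<Sum>n\<in>S. c' n / (y - of_int n))"
      unfolding sum.distrib[symmetric]
      by (intro sum.cong refl) (simp only: c'S add_divide_distrib[symmetric] distrib_left mult_1_right)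
    also have "1 - (\<Sum>n\<in>S. c n * (e / (of_int n - of_int s))) = c' s"
      unfolding c'_def e_swap by simp
    finally show ?thesis using sS fin by (simp add: add.commute)
  qed
  then show ?case using nn sumc by blast
qed

text \<open>The residues \<open>c\<close> serve as test sequence. At \<open>y = m - 1/2\<close> one
  has \<open>1 / (y - n) = - cauchy_kernel (n - m)\<close>, so nonnegativity of the product says
  that \<open>s\<close> times the transposed kernel applied to \<open>c\<close> is at most 2.
  Pairing with \<open>a\<close> and using that \<open>c\<close> has mass \<open>card S\<close> gives
  the bound. The sign \<open>s\<close> selects the upper or the lower level set.\<close>

lemma card_fconv_cauchy_kernel_nonneg:
  fixes s t :: real and a :: "int \<Rightarrow> real"
  assumes fin: "finite F" "finite S" and a: "\<And>m. m \<in> F \<Longrightarrow> 0 \<le> a m"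
    and s: "s = 1 \<or> s = -1" and gt: "\<And>n. n \<in> S \<Longrightarrow> t \<le> s * fconv cauchy_kernel F a n"
  shows "card S * t \<le> 2 * (\<Sum>m\<in>F. a m)"
proof -
  obtain c :: "int \<Rightarrow> real" where c: "\<forall>n\<in>S. 0 \<le> c n" "sum c S = card S"
    and prod: "\<And>y::real. y \<notin> of_int ` S \<Longrightarrow>
      (\<Prod>n\<in>S. 1 + (s/2) / (y - of_int n)) = 1 + (s/2) * (\<Sum>n\<in>S. c n / (y - of_int n))"
    using partial_fraction_weights[of S "s/2"] fin s by auto
  have le2: "s * (\<Sum>n\<in>S. c n * cauchy_kernel (n - m)) \<le> 2" for m
  proof -
    have "real_of_int m - 1/2 \<noteq> of_int n" for n
      using half_shift_neq_0[of "n - m"] by auto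
    then have y: "real_of_int m - 1/2 \<notin> of_int ` S" by blast
    \<comment> \<open>A half-integer is at distance at least 1/2 from every integer, so the
      parameter of modulus 1/2 keeps every factor nonnegative.\<close>
    have "0 \<le> 1 + (s/2) / (real_of_int m - 1/2 - of_int n)" for n
    proof (cases "n < m")
      case True
      then have "real_of_int m - 1/2 - of_int n \<ge> 1/2" by linarith
      then show ?thesis using s by (auto simp: divide_simps)
    next
      case False
      then have "real_of_int m - 1/2 - of_int n \<le> -1/2" by linarith
      then show ?thesis using s by (auto simp: divide_simps)
    qed
    then have "0 \<le> 1 + (s/2) * (\<Sum>n\<in>S. c n / (real_of_int m - 1/2 - of_int n))"
      unfolding prod[OF y, symmetric] by (intro prod_nonneg) blast
    also have "(\<Sum>n\<in>S. c n / (real_of_int m - 1/2 - of_int n)) = - (\<Sum>n\<in>S. c n * cauchy_kernel (n - m))"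
      unfolding sum_negf[symmetric] cauchy_kernel_def
    proof (intro sum.cong refl)
      fix n
      have "real_of_int m - 1/2 - of_int n = - (real_of_int (n - m) + 1/2)" by simp
      then show "c n / (real_of_int m - 1/2 - of_int n) = - (c n * (1 / (real_of_int (n - m) + 1/2)))"
        by (simp only: divide_minus_right times_divide_eq_right mult_1_right)
    qed
    finally show ?thesis by simp
  qed
  have "card S * t = (\<Sum>n\<in>S. c n * t)" by (simp add: sum_distrib_right[symmetric] c)
  also have "\<dots> \<le> (\<Sum>n\<in>S. c n * (s * fconv cauchy_kernel F a n))"
    using gt c by (intro sum_mono mult_left_mono) auto
  also have "\<dots> = (\<Sum>m\<in>F. s * (\<Sum>n\<in>S. c n * cauchy_kernel (n - m)) * a m)"
    unfolding fconv_def sum_distrib_left sum_distrib_right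
    by (subst sum.swap) (simp add: mult_ac)
  also have "\<dots> \<le> (\<Sum>m\<in>F. 2 * a m)"
    using le2 a by (intro sum_mono mult_right_mono) auto
  finally show ?thesis by (simp add: sum_distrib_left)
qed

text \<open>Positive and negative parts \<open>u\<close>, \<open>v\<close>, each with two signs,
  give four level sets at height \<open>t / 2\<close>. Each costs \<open>4 / t\<close> times the
  mass of its part, and each part occurs twice, hence the constant 8.\<close>

lemma card_fconv_cauchy_kernel:
  fixes t :: real and a :: "int \<Rightarrow> real"
  assumes fin: "finite F" "finite S" and "0 < t"
    and gt: "\<And>n. n \<in> S \<Longrightarrow> t < \<bar>fconv cauchy_kernel F a n\<bar>"
  shows "card S * t \<le> 8 * (\<Sum>m\<in>F. \<bar>a m\<bar>)"
proof -
  let ?T = "\<lambda>s b. {n\<in>S. t/2 \<le> s * fconv cauchy_kernel F b n}"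
  define u where "u m = max (a m) 0" for m
  define v where "v m = max (- a m) 0" for m
  have uv: "fconv cauchy_kernel F a n = fconv cauchy_kernel F u n - fconv cauchy_kernel F v n" for n
    unfolding fconv_def sum_subtractf[symmetric]
    by (intro sum.cong) (auto simp: u_def v_def max_def)
  have bd: "card (?T s b) * (t/2) \<le> 2 * (\<Sum>m\<in>F. b m)" if "s = 1 \<or> s = -1" "\<And>m. 0 \<le> b m" for s b
    by (rule card_fconv_cauchy_kernel_nonneg[OF fin(1) _ _ that(1)]) (use fin that in auto)
  have "n \<in> ?T 1 u \<union> ?T (-1) v \<union> (?T (-1) u \<union> ?T 1 v)" if "n \<in> S" for n
    using gt[OF that] uv[of n] that by auto
  then have "card S \<le> card (?T 1 u \<union> ?T (-1) v \<union> (?T (-1) u \<union> ?T 1 v))"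
    using fin by (intro card_mono) auto
  also have "\<dots> \<le> (card (?T 1 u) + card (?T (-1) v)) + (card (?T (-1) u) + card (?T 1 v))"
    by (intro card_Un_le[THEN order_trans] add_mono card_Un_le)
  finally have "real (card S) * t \<le> real \<dots> * t"
    using \<open>0 < t\<close> by (intro mult_right_mono) auto
  also have "\<dots> \<le> 8 * ((\<Sum>m\<in>F. u m) + (\<Sum>m\<in>F. v m))"
    using bd[of 1 u] bd[of "-1" u] bd[of 1 v] bd[of "-1" v]
    by (simp add: u_def v_def algebra_simps)
  also have "(\<Sum>m\<in>F. u m) + (\<Sum>m\<in>F. v m) = (\<Sum>m\<in>F. \<bar>a m\<bar>)"
    unfolding sum.distrib[symmetric] by (intro sum.cong) (auto simp: u_def v_def)
  finally show ?thesis .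
qed

subsection \<open>Convolution with summable kernels\<close>

text \<open>Convexity on the open half-line is extended to the endpoint 0, where it reduces to
  \<open>t powr p \<le> t\<close> for \<open>0 < t < 1\<close>.\<close>

lemma powr_convex_nonneg:
  fixes p :: real
  assumes "1 \<le> p"
  shows "convex_on {0..} (\<lambda>x::real. x powr p)"
proof (rule convex_on_linorderI)
  fix t x y :: real
  assume t: "0 < t" "t < 1" and xy: "x \<in> {0..}" "y \<in> {0..}" "x < y"
  show "((1 - t) *\<^sub>R x + t *\<^sub>R y) powr p \<le> (1 - t) * x powr p + t * y powr p"
  proof (cases "x = 0")
    case True
    have "t powr p \<le> t powr 1" using t assms by (intro powr_mono') auto
    then show ?thesis
      using True t xy by (auto simp: powr_mult intro!: mult_right_mono)
  next
    case False
    then show ?thesis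
      using convex_onD[OF powr_convex[OF assms], of t x y] t xy by auto
  qed
qed (simp add: convex_real_interval)

text \<open>Jensen's inequality with the normalised weights \<open>w i / W\<close>, followed by
  \<open>W \<le> B\<close>.\<close>

lemma powr_weighted_sum_le:
  fixes w b :: "'a \<Rightarrow> real"
  assumes p: "1 \<le> p" and fin: "finite F" and w: "\<And>i. i \<in> F \<Longrightarrow> 0 \<le> w i"
    and b: "\<And>i. i \<in> F \<Longrightarrow> 0 \<le> b i" and B: "sum w F \<le> B"
  shows "(\<Sum>i\<in>F. w i * b i) powr p \<le> B powr (p - 1) * (\<Sum>i\<in>F. w i * b i powr p)"
proof (cases "sum w F = 0")
  case True
  then have "\<forall>i\<in>F. w i = 0" using fin w by (simp add: sum_nonneg_eq_0_iff)
  then show ?thesis by simp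
next
  case False
  define W where "W = sum w F"
  have W: "W > 0" using False w sum_nonneg[of F w] by (simp add: W_def order_less_le)
  have "F \<noteq> {}" using False by auto
  then have "(\<Sum>i\<in>F. (w i / W) *\<^sub>R b i) powr p \<le> (\<Sum>i\<in>F. (w i / W) * b i powr p)"
    by (intro convex_on_sum[OF fin _ powr_convex_nonneg[OF p]])
       (use w b W in \<open>auto simp: W_def sum_divide_distrib[symmetric]\<close>)
  then have *: "((\<Sum>i\<in>F. w i * b i) / W) powr p \<le> (\<Sum>i\<in>F. w i * b i powr p) / W"
    by (simp add: sum_divide_distrib)
  have "(\<Sum>i\<in>F. w i * b i) powr p = W powr p * ((\<Sum>i\<in>F. w i * b i) / W) powr p"
    using W w b by (simp add: powr_mult[symmetric] sum_nonneg)
  also have "\<dots> \<le> W powr p * ((\<Sum>i\<in>F. w i * b i powr p) / W)"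
    using * by (intro mult_left_mono) auto
  also have "\<dots> = W powr (p - 1) * (\<Sum>i\<in>F. w i * b i powr p)"
    using W by (simp add: powr_diff)
  also have "\<dots> \<le> B powr (p - 1) * (\<Sum>i\<in>F. w i * b i powr p)"
    using W B p w by (intro mult_right_mono powr_mono2 sum_nonneg) (auto simp: W_def)
  finally show ?thesis .
qed

lemma powr_add_le:
  fixes x y p :: real
  assumes "0 \<le> x" "0 \<le> y" "0 \<le> p"
  shows "(x + y) powr p \<le> 2 powr p * (x powr p + y powr p)"
proof -
  have "(x + y) powr p \<le> (2 * max x y) powr p"
    using assms by (intro powr_mono2) auto
  also have "\<dots> = 2 powr p * max x y powr p"
    using assms by (simp add: powr_mult)
  also have "\<dots> \<le> 2 powr p * (x powr p + y powr p)"
    by (intro mult_left_mono) (auto simp: max_def)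
  finally show ?thesis .
qed

lemma ell_one_iff: "K \<in> ell 1 \<longleftrightarrow> (\<lambda>n. norm (K n)) summable_on UNIV"
  by (simp add: ell_def)

lemma ell_norm_one: "ell_norm 1 K = (\<Sum>\<^sub>\<infinity>n. norm (K n))"
  by (simp add: ell_norm_def infsum_nonneg)

lemma ell_norm_nonneg: "0 \<le> ell_norm p a"
  by (simp add: ell_norm_def)

lemma sum_norm_le_ell_norm_one:
  assumes "K \<in> ell 1" "finite G"
  shows "(\<Sum>n\<in>G. norm (K n)) \<le> ell_norm 1 K"
  unfolding ell_norm_one using assms by (intro finite_sum_le_infsum) (auto simp: ell_one_iff)

text \<open>Schur's test: the row sums of the matrix \<open>\<bar>K (n - m)\<bar>\<close> enter
  through Jensen with the power \<open>p - 1\<close>, the column sums after exchanging the sums with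
  the power 1. Both are at most the \<open>\<ell>\<close>-1 norm of \<open>K\<close>, so no constant
  is lost.\<close>

lemma young_convolution_finite:
  fixes K :: "int \<Rightarrow> real"
  assumes p: "1 \<le> p" and K: "K \<in> ell 1" and fin: "finite S" "finite F"
    and b: "\<And>m. m \<in> F \<Longrightarrow> 0 \<le> b m"
  shows "(\<Sum>n\<in>S. (\<Sum>m\<in>F. \<bar>K (n - m)\<bar> * b m) powr p) \<le> ell_norm 1 K powr p * (\<Sum>m\<in>F. b m powr p)"
proof -
  let ?B = "ell_norm 1 K"
  have row: "(\<Sum>m\<in>F. \<bar>K (n - m)\<bar>) \<le> ?B" for n
  proof -
    have "(\<Sum>m\<in>F. \<bar>K (n - m)\<bar>) = (\<Sum>j\<in>(\<lambda>m. n - m) ` F. \<bar>K j\<bar>)"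
      by (subst sum.reindex) (auto simp: inj_on_def)
    then show ?thesis using sum_norm_le_ell_norm_one[OF K, of "(\<lambda>m. n - m) ` F"] fin by simp
  qed
  have col: "(\<Sum>n\<in>S. \<bar>K (n - m)\<bar>) \<le> ?B" for m
  proof -
    have "(\<Sum>n\<in>S. \<bar>K (n - m)\<bar>) = (\<Sum>j\<in>(\<lambda>n. n - m) ` S. \<bar>K j\<bar>)"
      by (subst sum.reindex) (auto simp: inj_on_def)
    then show ?thesis using sum_norm_le_ell_norm_one[OF K, of "(\<lambda>n. n - m) ` S"] fin by simp
  qed
  have "(\<Sum>n\<in>S. (\<Sum>m\<in>F. \<bar>K (n - m)\<bar> * b m) powr p)
      \<le> (\<Sum>n\<in>S. ?B powr (p - 1) * (\<Sum>m\<in>F. \<bar>K (n - m)\<bar> * b m powr p))"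
    by (intro sum_mono powr_weighted_sum_le) (use p fin b row in auto)
  also have "\<dots> = ?B powr (p - 1) * (\<Sum>m\<in>F. (\<Sum>n\<in>S. \<bar>K (n - m)\<bar>) * b m powr p)"
    unfolding sum_distrib_left sum_distrib_right by (rule sum.swap)
  also have "\<dots> \<le> ?B powr (p - 1) * (\<Sum>m\<in>F. ?B * b m powr p)"
    using col by (intro mult_left_mono sum_mono mult_right_mono) auto
  also have "\<dots> = ?B powr p * (\<Sum>m\<in>F. b m powr p)"
  proof (cases "?B = 0")
    case False
    then have "?B > 0" using ell_norm_nonneg[of 1 K] by linarith
    then show ?thesis by (simp add: sum_distrib_left[symmetric] powr_diff)
  qed simp
  finally show ?thesis .
qed

lemma fconv_powr_le:
  assumes "1 \<le> p" "K \<in> ell 1" "finite S" "finite F"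
  shows "(\<Sum>n\<in>S. \<bar>fconv K F a n\<bar> powr p) \<le> ell_norm 1 K powr p * (\<Sum>m\<in>F. \<bar>a m\<bar> powr p)"
proof -
  have "\<bar>fconv K F a n\<bar> \<le> (\<Sum>m\<in>F. \<bar>K (n - m)\<bar> * \<bar>a m\<bar>)" for n
    unfolding fconv_def by (rule order_trans[OF sum_abs]) (simp add: abs_mult)
  then have "(\<Sum>n\<in>S. \<bar>fconv K F a n\<bar> powr p) \<le> (\<Sum>n\<in>S. (\<Sum>m\<in>F. \<bar>K (n - m)\<bar> * \<bar>a m\<bar>) powr p)"
    using assms by (intro sum_mono powr_mono2) auto
  also have "\<dots> \<le> ell_norm 1 K powr p * (\<Sum>m\<in>F. \<bar>a m\<bar> powr p)"
    using assms by (intro young_convolution_finite) auto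
  finally show ?thesis .
qed

section \<open>Summability over the half-integers\<close>

text \<open>The reflection sending \<open>n\<close> to \<open>- n - 1\<close> preserves
  \<open>\<bar>n + 1/2\<bar>\<close> and exchanges the nonnegative with the negative integers, so
  both halves are the same series over the naturals.\<close>

lemma summable_half_shift_powr:
  assumes s: "1 < s"
  shows "(\<lambda>n::int. \<bar>real_of_int n + 1/2\<bar> powr - s) summable_on UNIV"
proof -
  let ?f = "\<lambda>n::int. \<bar>real_of_int n + 1/2\<bar> powr - s"
  have nat: "(\<lambda>n::nat. (real n + 1/2) powr - s) summable_on UNIV"
  proof -
    have "summable (\<lambda>n. real n powr - s)" using s by (simp add: summable_real_powr_iff)
    \<comment> \<open>The dominating series starts at 1: since \<open>0 powr - s\<close> is 0, it
      would not dominate the term with index 0.\<close>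
    then have dom: "summable (\<lambda>n. real (Suc n) powr - s)"
      by (rule summable_ignore_initial_segment[of _ 1, unfolded One_nat_def add_Suc_right add_0_right])
    have "norm ((real (Suc n) + 1/2) powr - s) \<le> real (Suc n) powr - s" for n
    proof -
      have "(real (Suc n) + 1/2) powr - s \<le> real (Suc n) powr - s"
        using s by (intro powr_mono2') auto
      then show ?thesis by (simp only: real_norm_def abs_of_nonneg[OF powr_ge_zero])
    qed
    then have "summable (\<lambda>n. (real (Suc n) + 1/2) powr - s)"
      by (intro summable_comparison_test'[OF dom, of 0])
    then have "summable (\<lambda>n. (real n + 1/2) powr - s)"
      by (rule iffD1[OF summable_Suc_iff])
    then show ?thesis by (subst summable_on_UNIV_nonneg_real_iff) auto
  qed
  have "?f summable_on range int"
    by (subst summable_on_reindex) (use nat in \<open>auto simp: o_def inj_on_def\<close>)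
  moreover have "?f summable_on range (\<lambda>n. - int n - 1)"
  proof (subst summable_on_reindex)
    have "?f \<circ> (\<lambda>n. - int n - 1) = (\<lambda>n::nat. (real n + 1/2) powr - s)"
    proof
      fix n :: nat
      have "\<bar>real_of_int (- int n - 1) + 1/2\<bar> = real n + 1/2" by simp
      then show "(?f \<circ> (\<lambda>n. - int n - 1)) n = (real n + 1/2) powr - s" by (metis comp_apply)
    qed
    then show "(?f \<circ> (\<lambda>n. - int n - 1)) summable_on UNIV" using nat by simp
  qed (auto simp: inj_on_def)
  moreover have "range int \<union> range (\<lambda>n. - int n - 1) = UNIV"
  proof -
    have "x \<in> range int \<union> range (\<lambda>n. - int n - 1)" for x :: int
    proof (cases "0 \<le> x")
      case True then have "x = int (nat x)" by simp
      then show ?thesis by blast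
    next
      case False then have "x = - int (nat (- x - 1)) - 1" by simp
      then show ?thesis by blast
    qed
    then show ?thesis by blast
  qed
  ultimately show ?thesis by (metis summable_on_union)
qed

text \<open>The common summability test for the three error kernels: the squared Cauchy kernel, its
  difference to the punctured kernel, and \<open>D\<close>.\<close>

lemma ell_one_of_quadratic_decay:
  fixes K :: "int \<Rightarrow> real"
  assumes "\<And>n. \<bar>K n\<bar> \<le> C / (real_of_int n + 1/2)\<^sup>2"
  shows "K \<in> ell 1"
proof -
  have "(\<lambda>n::int. C * \<bar>real_of_int n + 1/2\<bar> powr - 2) summable_on UNIV"
    by (intro summable_on_cmult_right summable_half_shift_powr) simp
  moreover have "norm (K n) \<le> C * \<bar>real_of_int n + 1/2\<bar> powr - 2" for n
  proof -
    have "0 < \<bar>real_of_int n + 1/2\<bar>" using half_shift_neq_0[of n] by simp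
    then have "\<bar>real_of_int n + 1/2\<bar> powr - 2 = 1 / (real_of_int n + 1/2)\<^sup>2"
      by (simp only: powr_minus powr_numeral power2_abs inverse_eq_divide)
    then show ?thesis using assms[of n] by (simp only: real_norm_def times_divide_eq_right mult_1_right)
  qed
  ultimately show ?thesis
    unfolding ell_one_iff by (intro Infinite_Sum.abs_summable_on_comparison_test'[where g = "\<lambda>n. C * \<bar>real_of_int n + 1/2\<bar> powr - 2"]) auto
qed

subsection \<open>Cotlar's identity and exponents \<open>2 ^ j\<close>\<close>

text \<open>Since \<open>1 / 0 = 0\<close>, the diagonal term vanishes.\<close>

definition punctured_kernel :: "int \<Rightarrow> real" where
  "punctured_kernel n = 1 / real_of_int n"

lemma punctured_kernel_0 [simp]: "punctured_kernel 0 = 0"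
  by (simp add: punctured_kernel_def)

lemma punctured_kernel_minus: "punctured_kernel (m - n) = - punctured_kernel (n - m)"
  by (simp add: punctured_kernel_def divide_simps)

lemma abs_half_shift_ge: "1/2 \<le> \<bar>real_of_int n + 1/2\<bar>"
proof (cases "0 \<le> n")
  case False
  then have "real_of_int n \<le> -1" by linarith
  then show ?thesis by linarith
qed simp

lemma cauchy_kernel_power2_ell_one: "(\<lambda>n. (cauchy_kernel n)\<^sup>2) \<in> ell 1"
  by (rule ell_one_of_quadratic_decay[where C = 1])
     (simp only: cauchy_kernel_def abs_divide abs_power2 power_divide power_one abs_one order_refl)

text \<open>Cotlar's identity mixes two kernels. This lets the punctured one be exchanged for the
  Cauchy kernel up to an operator controlled by Young's inequality.\<close>

lemma punctured_minus_cauchy_ell_one: "(\<lambda>n. punctured_kernel n - cauchy_kernel n) \<in> ell 1"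
proof (rule ell_one_of_quadratic_decay[where C = 1])
  fix n :: int
  show "\<bar>punctured_kernel n - cauchy_kernel n\<bar> \<le> 1 / (real_of_int n + 1/2)\<^sup>2"
  proof (cases "n = 0")
    \<comment> \<open>Here the punctured kernel is 0 by convention and the Cauchy kernel is 2,
      against a bound of 4.\<close>
    case True
    then show ?thesis by (simp add: cauchy_kernel_def power2_eq_square)
  next
    case False
    define x where "x = real_of_int n"
    have x: "\<bar>x\<bar> \<ge> 1" using False by (simp add: x_def)
    then have nz: "x \<noteq> 0" "x + 1/2 \<noteq> 0" by auto
    have "1 / x - 1 / (x + 1/2) = 1 / (2 * x * (x + 1/2))"
      using nz by (simp add: divide_simps)
    moreover have "\<bar>x + 1/2\<bar> \<le> 2 * \<bar>x\<bar>" using x by linarith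
    then have "(x + 1/2)\<^sup>2 \<le> \<bar>2 * x * (x + 1/2)\<bar>"
      using mult_right_mono[of "\<bar>x + 1/2\<bar>" "2 * \<bar>x\<bar>" "\<bar>x + 1/2\<bar>"]
      by (simp only: power2_eq_square abs_mult abs_mult_self_eq abs_numeral abs_ge_zero)
    then have "\<bar>1 / (2 * x * (x + 1/2))\<bar> \<le> 1 / (x + 1/2)\<^sup>2"
      using nz by (simp only: abs_divide abs_one) (intro divide_left_mono, auto)
    ultimately show ?thesis by (simp only: punctured_kernel_def cauchy_kernel_def x_def)
  qed
qed

text \<open>Partial fractions in \<open>n\<close>. The shift 1/2 cancels in the difference of the
  two denominators, which is why the kernel \<open>1 / n\<close> at integers appears.\<close>

lemma cauchy_kernel_mult:
  assumes "j \<noteq> k"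
  shows "cauchy_kernel (n - j) * cauchy_kernel (n - k)
    = cauchy_kernel (n - j) * punctured_kernel (j - k) + cauchy_kernel (n - k) * punctured_kernel (k - j)"
proof -
  have key: "1 / x * (1 / y) = 1 / x * (1 / d) + 1 / y * - (1 / d)"
    if "x \<noteq> 0" "y \<noteq> 0" "d \<noteq> 0" "d = y - x" for x y d :: real
  proof -
    have "1 / x - 1 / y = d * (1 / (x * y))" using that by (simp add: diff_frac_eq)
    then have "(1 / x - 1 / y) * (1 / d) = 1 / (x * y)" using that(3) by simp
    then show ?thesis by (simp add: diff_divide_distrib)
  qed
  show ?thesis
    unfolding punctured_kernel_minus[of k j] unfolding cauchy_kernel_def punctured_kernel_def
    by (rule key[OF half_shift_neq_0 half_shift_neq_0]) (use assms in simp_all)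
qed

text \<open>On the line Cotlar's identity reads \<open>(Hf)\<^sup>2 = f\<^sup>2 + 2 H(f Hf)\<close>.\<close>

lemma cotlar_identity:
  assumes "finite F"
  shows "(fconv cauchy_kernel F a n)\<^sup>2 =
    2 * fconv cauchy_kernel F (\<lambda>j. a j * fconv punctured_kernel F a j) n
    + fconv (\<lambda>n. (cauchy_kernel n)\<^sup>2) F (\<lambda>j. (a j)\<^sup>2) n"
proof -
  let ?k = cauchy_kernel and ?h = punctured_kernel
  have "(fconv ?k F a n)\<^sup>2 = (\<Sum>j\<in>F. \<Sum>k\<in>F. ?k (n - j) * ?k (n - k) * (a j * a k))"
    unfolding fconv_def power2_eq_square sum_product by (simp add: mult_ac)
  \<comment> \<open>Off the diagonal this is \<open>cauchy_kernel_mult\<close>. On the diagonal both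
    punctured terms vanish and the squared kernel is left over.\<close>
  also have "\<dots> = (\<Sum>j\<in>F. \<Sum>k\<in>F. ?k (n - j) * ?h (j - k) * (a j * a k)
      + ?k (n - k) * ?h (k - j) * (a j * a k)
      + (if k = j then (?k (n - j))\<^sup>2 * (a j)\<^sup>2 else 0))"
  proof (intro sum.cong refl)
    fix j k
    show "?k (n - j) * ?k (n - k) * (a j * a k) = ?k (n - j) * ?h (j - k) * (a j * a k)
      + ?k (n - k) * ?h (k - j) * (a j * a k) + (if k = j then (?k (n - j))\<^sup>2 * (a j)\<^sup>2 else 0)"
    proof (cases "k = j")
      case True
      then show ?thesis by (simp add: power2_eq_square)
    next
      case False
      then show ?thesis unfolding cauchy_kernel_mult[OF False[symmetric]] distrib_right by simp
    qed
  qed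
  also have "\<dots> = (\<Sum>j\<in>F. \<Sum>k\<in>F. ?k (n - j) * ?h (j - k) * (a j * a k))
      + (\<Sum>j\<in>F. \<Sum>k\<in>F. ?k (n - k) * ?h (k - j) * (a j * a k))
      + (\<Sum>j\<in>F. (?k (n - j))\<^sup>2 * (a j)\<^sup>2)"
    using assms by (simp add: sum.distrib)
  also have "(\<Sum>j\<in>F. \<Sum>k\<in>F. ?k (n - k) * ?h (k - j) * (a j * a k))
      = (\<Sum>j\<in>F. \<Sum>k\<in>F. ?k (n - j) * ?h (j - k) * (a j * a k))"
    by (subst sum.swap) (simp add: mult.commute[of "a _" "a _"])
  also have "(\<Sum>j\<in>F. \<Sum>k\<in>F. ?k (n - j) * ?h (j - k) * (a j * a k))
      = fconv ?k F (\<lambda>j. a j * fconv ?h F a j) n"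
    unfolding fconv_def by (simp add: sum_distrib_left mult_ac)
  finally show ?thesis by (simp add: fconv_def)
qed

section \<open>Uniform bounds for finite sums\<close>

text \<open>An a priori form of boundedness: one constant serves all finite \<open>F\<close> and
  \<open>S\<close>, so that no question of convergence arises before the passage to the limit.
  \<open>A\<close> bounds sums of powers, so it corresponds to the power \<open>p\<close> of an
  operator norm.\<close>

definition fconv_bounded :: "(int \<Rightarrow> real) \<Rightarrow> real \<Rightarrow> bool" where
  "fconv_bounded K p \<longleftrightarrow> (\<exists>A\<ge>0. \<forall>F S a. finite F \<longrightarrow> finite S \<longrightarrow>
     (\<Sum>n\<in>S. \<bar>fconv K F a n\<bar> powr p) \<le> A * (\<Sum>m\<in>F. \<bar>a m\<bar> powr p))"

lemma cauchy_kernel_minus: "cauchy_kernel (- n - 1) = - cauchy_kernel n"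
proof -
  have "real_of_int (- n - 1) + 1/2 = - (real_of_int n + 1/2)" by simp
  then show ?thesis by (simp only: cauchy_kernel_def divide_minus_right)
qed

lemma tendsto_cauchy_kernel: "(\<lambda>N. cauchy_kernel (int N + c)) \<longlonglongrightarrow> 0"
proof -
  have "filterlim (\<lambda>N. (real_of_int c + 1/2) + real N) at_top sequentially"
    by (intro filterlim_tendsto_add_at_top[OF tendsto_const] filterlim_real_sequentially)
  then have "(\<lambda>N. inverse ((real_of_int c + 1/2) + real N)) \<longlonglongrightarrow> 0"
    by (rule tendsto_inverse_0_at_top)
  then show ?thesis by (simp add: cauchy_kernel_def inverse_eq_divide add_ac)
qed

text \<open>The kernel is odd about \<open>-1/2\<close>, and so is the window; for
  \<open>m = 0\<close> the sum cancels exactly. A unit shift only changes two boundary terms, which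
  tend to 0, so induction in both directions reaches every \<open>m\<close>.\<close>

lemma sum_cauchy_kernel_shift_tendsto:
  "(\<lambda>N. \<Sum>n\<in>{- int N..<int N}. cauchy_kernel (n - m)) \<longlonglongrightarrow> 0"
proof -
  let ?f = "\<lambda>m N. \<Sum>n\<in>{- int N..<int N}. cauchy_kernel (n - m)"
  have step: "(\<lambda>N. ?f (m + 1) N - ?f m N) \<longlonglongrightarrow> 0" for m
  proof -
    \<comment> \<open>The sums telescope: one term enters at the left end of the window and one
      leaves at the right end.\<close>
    have "?f (m + 1) N - ?f m N = cauchy_kernel (- int N - 1 - m) - cauchy_kernel (int N - 1 - m)" for N
    proof (induction N)
      case (Suc N)
      have "{- int (Suc N)..<int (Suc N)} = insert (- int N - 1) (insert (int N) {- int N..<int N})"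
        by auto
      then show ?case using Suc.IH by (simp add: algebra_simps)
    qed simp
    moreover have "cauchy_kernel (- int N - 1 - m) = - cauchy_kernel (int N + m)" for N
    proof -
      have "- int N - 1 - m = - (int N + m) - 1" by simp
      then show ?thesis by (simp only: cauchy_kernel_minus)
    qed
    moreover have "int N - 1 - m = int N + (- 1 - m)" for N by simp
    ultimately have eq: "(\<lambda>N. ?f (m + 1) N - ?f m N)
        = (\<lambda>N. - cauchy_kernel (int N + m) - cauchy_kernel (int N + (- 1 - m)))" by presburger
    have "(\<lambda>N. - cauchy_kernel (int N + m) - cauchy_kernel (int N + (- 1 - m))) \<longlonglongrightarrow> - 0 - 0"
      by (intro tendsto_intros tendsto_cauchy_kernel)
    then show ?thesis unfolding eq by simp
  qed
  show "?f m \<longlonglongrightarrow> 0"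
  proof (induction m rule: int_induct[where k = 0])
    case base
    have "?f 0 N = 0" for N
    proof (induction N)
      case (Suc N)
      have "{- int (Suc N)..<int (Suc N)} = insert (- int N - 1) (insert (int N) {- int N..<int N})"
        by auto
      then show ?case using Suc.IH cauchy_kernel_minus[of "int N"] by (simp add: algebra_simps)
    qed simp
    then show ?case by simp
  next
    case (step1 m)
    then show ?case using tendsto_add[OF step1.IH step[of m]] by simp
  next
    case (step2 m)
    then show ?case using tendsto_diff[OF step2.IH step[of "m - 1"]] by simp
  qed
qed

text \<open>Cotlar's identity is summed over growing windows. The term linear in the kernel
  disappears in the limit because the window sums of the kernel tend to 0, and the squared kernel is
  handled by Young's inequality with exponent 1.\<close>

lemma fconv_cauchy_kernel_bounded_2: "fconv_bounded cauchy_kernel 2"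
  unfolding fconv_bounded_def
proof (intro exI[of _ "ell_norm 1 (\<lambda>n. (cauchy_kernel n)\<^sup>2)"] conjI allI impI)
  let ?q = "ell_norm 1 (\<lambda>n. (cauchy_kernel n)\<^sup>2)"
  show "0 \<le> ?q" by (rule ell_norm_nonneg)
  fix F S :: "int set" and a :: "int \<Rightarrow> real"
  assume fin: "finite F" "finite S"
  let ?I = "\<lambda>N. {- int N..<int N}"
  define b where "b = (\<lambda>j. a j * fconv punctured_kernel F a j)"
  let ?g = "\<lambda>N. 2 * (\<Sum>m\<in>F. b m * (\<Sum>n\<in>?I N. cauchy_kernel (n - m))) + ?q * (\<Sum>m\<in>F. (a m)\<^sup>2)"
  have le: "(\<Sum>n\<in>?I N. (fconv cauchy_kernel F a n)\<^sup>2) \<le> ?g N" for N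
  proof -
    have "(\<Sum>n\<in>?I N. (fconv cauchy_kernel F a n)\<^sup>2) = 2 * (\<Sum>n\<in>?I N. fconv cauchy_kernel F b n)
        + (\<Sum>n\<in>?I N. fconv (\<lambda>n. (cauchy_kernel n)\<^sup>2) F (\<lambda>j. (a j)\<^sup>2) n)"
      by (simp add: cotlar_identity[OF fin(1)] sum.distrib sum_distrib_left b_def)
    also have "(\<Sum>n\<in>?I N. fconv cauchy_kernel F b n) = (\<Sum>m\<in>F. b m * (\<Sum>n\<in>?I N. cauchy_kernel (n - m)))"
      unfolding fconv_def sum_distrib_left by (subst sum.swap) (simp add: mult.commute)
    also have "(\<Sum>n\<in>?I N. fconv (\<lambda>n. (cauchy_kernel n)\<^sup>2) F (\<lambda>j. (a j)\<^sup>2) n)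
        \<le> (\<Sum>n\<in>?I N. \<bar>fconv (\<lambda>n. (cauchy_kernel n)\<^sup>2) F (\<lambda>j. (a j)\<^sup>2) n\<bar> powr 1)"
      by (intro sum_mono) simp
    also have "\<dots> \<le> ?q powr 1 * (\<Sum>m\<in>F. \<bar>(a m)\<^sup>2\<bar> powr 1)"
      by (intro fconv_powr_le cauchy_kernel_power2_ell_one fin) auto
    finally show ?thesis using ell_norm_nonneg[of 1 "\<lambda>n. (cauchy_kernel n)\<^sup>2"] by simp
  qed
  have "?g \<longlonglongrightarrow> 2 * (\<Sum>m\<in>F. b m * 0) + ?q * (\<Sum>m\<in>F. (a m)\<^sup>2)"
    by (intro tendsto_intros sum_cauchy_kernel_shift_tendsto)
  then have lim: "?g \<longlonglongrightarrow> ?q * (\<Sum>m\<in>F. (a m)\<^sup>2)" by simp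
  obtain M where M: "S \<subseteq> ?I M"
  proof
    show "S \<subseteq> ?I (nat (Max (insert 0 (abs ` S)) + 1))"
    proof
      fix n assume "n \<in> S"
      then have "\<bar>n\<bar> \<le> Max (insert 0 (abs ` S))" using fin by (intro Max_ge) auto
      then show "n \<in> ?I (nat (Max (insert 0 (abs ` S)) + 1))" by auto
    qed
  qed
  have "(\<Sum>n\<in>S. (fconv cauchy_kernel F a n)\<^sup>2) \<le> ?g N" if "N \<ge> M" for N
  proof -
    have "S \<subseteq> ?I N" using M that by fastforce
    then have "(\<Sum>n\<in>S. (fconv cauchy_kernel F a n)\<^sup>2) \<le> (\<Sum>n\<in>?I N. (fconv cauchy_kernel F a n)\<^sup>2)"
      by (intro sum_mono2) auto
    then show ?thesis using le[of N] by linarith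
  qed
  then have "(\<Sum>n\<in>S. (fconv cauchy_kernel F a n)\<^sup>2) \<le> ?q * (\<Sum>m\<in>F. (a m)\<^sup>2)"
    by (intro LIMSEQ_le_const[OF lim]) blast
  then show "(\<Sum>n\<in>S. \<bar>fconv cauchy_kernel F a n\<bar> powr 2) \<le> ?q * (\<Sum>m\<in>F. \<bar>a m\<bar> powr 2)"
    by simp
qed

text \<open>The term \<open>a H a\<close> of Cotlar's identity is split by the inequality between arithmetic and geometric
  means with a weight \<open>\<delta>\<close> so small that the resulting \<open>H a\<close> part is absorbed on the left.\<close>

lemma fconv_cauchy_kernel_bounded_double:
  assumes p: "1 \<le> p" and bdd: "fconv_bounded cauchy_kernel p"
  shows "fconv_bounded cauchy_kernel (2 * p)"
proof -
  obtain A where A: "0 \<le> A" and bound: "\<And>F S a. finite F \<Longrightarrow> finite S \<Longrightarrow>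
     (\<Sum>n\<in>S. \<bar>fconv cauchy_kernel F a n\<bar> powr p) \<le> A * (\<Sum>m\<in>F. \<bar>a m\<bar> powr p)"
    using bdd unfolding fconv_bounded_def by auto
  let ?Q = "\<lambda>n. (cauchy_kernel n)\<^sup>2" and ?E = "\<lambda>n. punctured_kernel n - cauchy_kernel n"
  define B where "B = 2 powr p * 2 powr p * A"
  define G where "G = (2::real) powr (2 * p)"
  define R where "R = 2 powr p * ell_norm 1 ?Q powr p"
  define e where "e = ell_norm 1 ?E powr (2 * p)"
  \<comment> \<open>\<open>B\<close> and \<open>R\<close> come from Cotlar's identity,
    \<open>G\<close> and \<open>e\<close> from replacing the punctured kernel. This
    \<open>\<delta>\<close> makes \<open>B * G * \<delta>\<close> at most 1.\<close>
  define \<delta> where "\<delta> = 1 / (B * G + 1)"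
  have nonneg: "0 \<le> B" "0 \<le> G" "0 \<le> R" "0 \<le> e" using A by (auto simp: B_def G_def R_def e_def)
  then have \<delta>: "0 < \<delta>" "B * G * \<delta> \<le> 1" by (auto simp: \<delta>_def divide_simps add_nonneg_pos)
  have square_powr: "(x\<^sup>2) powr p = \<bar>x\<bar> powr (2 * p)" for x :: real
  proof -
    have "\<bar>x\<bar> powr (2 * p) = (\<bar>x\<bar> powr 2) powr p" by (simp only: powr_powr)
    then show ?thesis by simp
  qed
  show ?thesis
    unfolding fconv_bounded_def
  proof (intro exI[of _ "B / \<delta> + e + 2 * R"] conjI allI impI)
    show "0 \<le> B / \<delta> + e + 2 * R" using nonneg \<delta> by simp
    fix F S :: "int set" and a :: "int \<Rightarrow> real"
    assume fin: "finite F" "finite S"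
    \<comment> \<open>The estimate for \<open>Z\<close> needs the transform on \<open>F\<close>, the
      claim needs it on \<open>S\<close>. Working on the union makes the quantity to be absorbed the
      same as the one being bounded.\<close>
    define T where "T = S \<union> F"
    have T: "finite T" "S \<subseteq> T" "F \<subseteq> T" using fin by (auto simp: T_def)
    define b where "b j = a j * fconv punctured_kernel F a j" for j
    define X where "X = (\<Sum>n\<in>T. \<bar>fconv cauchy_kernel F a n\<bar> powr (2 * p))"
    define Y where "Y = (\<Sum>m\<in>F. \<bar>a m\<bar> powr (2 * p))"
    define Z where "Z = (\<Sum>m\<in>F. \<bar>b m\<bar> powr p)"
    have X: "X \<le> B * Z + R * Y"
    proof -
      have "\<bar>fconv cauchy_kernel F a n\<bar> powr (2 * p)
          \<le> 2 powr p * 2 powr p * \<bar>fconv cauchy_kernel F b n\<bar> powr p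
            + 2 powr p * \<bar>fconv ?Q F (\<lambda>j. (a j)\<^sup>2) n\<bar> powr p" for n
      proof -
        have "\<bar>fconv cauchy_kernel F a n\<bar> powr (2 * p) = ((fconv cauchy_kernel F a n)\<^sup>2) powr p"
          by (simp only: square_powr)
        also have "\<dots> = \<bar>(fconv cauchy_kernel F a n)\<^sup>2\<bar> powr p" by simp
        also have "\<dots> \<le> (2 * \<bar>fconv cauchy_kernel F b n\<bar> + \<bar>fconv ?Q F (\<lambda>j. (a j)\<^sup>2) n\<bar>) powr p"
          unfolding cotlar_identity[OF fin(1)] b_def[symmetric] using p by (intro powr_mono2) auto
        also have "\<dots> \<le> 2 powr p * ((2 * \<bar>fconv cauchy_kernel F b n\<bar>) powr p
            + \<bar>fconv ?Q F (\<lambda>j. (a j)\<^sup>2) n\<bar> powr p)"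
          using p by (intro powr_add_le) auto
        finally show ?thesis by (simp add: powr_mult distrib_left)
      qed
      then have "X \<le> 2 powr p * 2 powr p * (\<Sum>n\<in>T. \<bar>fconv cauchy_kernel F b n\<bar> powr p)
            + 2 powr p * (\<Sum>n\<in>T. \<bar>fconv ?Q F (\<lambda>j. (a j)\<^sup>2) n\<bar> powr p)"
        unfolding X_def sum_distrib_left sum.distrib[symmetric] by (intro sum_mono)
      also have "\<dots> \<le> 2 powr p * 2 powr p * (A * Z) + 2 powr p * (ell_norm 1 ?Q powr p * Y)"
      proof (intro add_mono mult_left_mono)
        show "(\<Sum>n\<in>T. \<bar>fconv cauchy_kernel F b n\<bar> powr p) \<le> A * Z"
          unfolding Z_def by (intro bound fin T)
        have "(\<Sum>n\<in>T. \<bar>fconv ?Q F (\<lambda>j. (a j)\<^sup>2) n\<bar> powr p)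
            \<le> ell_norm 1 ?Q powr p * (\<Sum>m\<in>F. \<bar>(a m)\<^sup>2\<bar> powr p)"
          by (intro fconv_powr_le cauchy_kernel_power2_ell_one p fin T)
        then show "(\<Sum>n\<in>T. \<bar>fconv ?Q F (\<lambda>j. (a j)\<^sup>2) n\<bar> powr p) \<le> ell_norm 1 ?Q powr p * Y"
          by (simp add: Y_def square_powr)
      qed auto
      finally show ?thesis by (simp add: B_def R_def mult_ac)
    qed
    have Z: "Z \<le> Y / (2 * \<delta>) + \<delta> / 2 * (G * (X + e * Y))"
    proof -
      have am_gm: "u * v \<le> u\<^sup>2 / (2 * \<delta>) + \<delta> / 2 * v\<^sup>2" for u v :: real
      proof -
        have "0 \<le> (u - \<delta> * v)\<^sup>2 / (2 * \<delta>)" using \<delta> by simp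
        also have "\<dots> = u\<^sup>2 / (2 * \<delta>) + \<delta> / 2 * v\<^sup>2 - u * v"
          using \<delta> by (simp add: power2_eq_square field_simps)
        finally show ?thesis by simp
      qed
      have powr_sq: "(\<bar>x\<bar> powr p)\<^sup>2 = \<bar>x\<bar> powr (2 * p)" for x :: real
        by (simp add: power2_eq_square powr_add[symmetric])
      have pw: "\<bar>b m\<bar> powr p \<le> \<bar>a m\<bar> powr (2 * p) / (2 * \<delta>)
          + \<delta> / 2 * \<bar>fconv punctured_kernel F a m\<bar> powr (2 * p)" for m
        using am_gm[of "\<bar>a m\<bar> powr p" "\<bar>fconv punctured_kernel F a m\<bar> powr p"]
        by (simp only: powr_sq b_def abs_mult powr_mult abs_ge_zero)
      have "\<bar>fconv punctured_kernel F a m\<bar> powr (2 * p)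
          \<le> G * (\<bar>fconv cauchy_kernel F a m\<bar> powr (2 * p) + \<bar>fconv ?E F a m\<bar> powr (2 * p))" for m
      proof -
        have "fconv punctured_kernel F a m = fconv cauchy_kernel F a m + fconv ?E F a m"
          by (simp add: fconv_def left_diff_distrib sum_subtractf)
        then have "\<bar>fconv punctured_kernel F a m\<bar> powr (2 * p)
            \<le> (\<bar>fconv cauchy_kernel F a m\<bar> + \<bar>fconv ?E F a m\<bar>) powr (2 * p)"
          using p by (intro powr_mono2) auto
        also have "\<dots> \<le> G * (\<bar>fconv cauchy_kernel F a m\<bar> powr (2 * p) + \<bar>fconv ?E F a m\<bar> powr (2 * p))"
          unfolding G_def using p by (intro powr_add_le) auto
        finally show ?thesis .
      qed
      then have "(\<Sum>m\<in>F. \<bar>fconv punctured_kernel F a m\<bar> powr (2 * p))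
          \<le> (\<Sum>m\<in>F. G * (\<bar>fconv cauchy_kernel F a m\<bar> powr (2 * p) + \<bar>fconv ?E F a m\<bar> powr (2 * p)))"
        by (intro sum_mono)
      also have "\<dots> = G * ((\<Sum>m\<in>F. \<bar>fconv cauchy_kernel F a m\<bar> powr (2 * p))
            + (\<Sum>m\<in>F. \<bar>fconv ?E F a m\<bar> powr (2 * p)))"
        by (simp only: sum_distrib_left[symmetric] sum.distrib)
      also have "\<dots> \<le> G * (X + e * Y)"
      proof (intro mult_left_mono add_mono)
        show "(\<Sum>m\<in>F. \<bar>fconv cauchy_kernel F a m\<bar> powr (2 * p)) \<le> X"
          unfolding X_def using T by (intro sum_mono2) auto
        show "(\<Sum>m\<in>F. \<bar>fconv ?E F a m\<bar> powr (2 * p)) \<le> e * Y"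
          unfolding e_def Y_def using p
          by (intro fconv_powr_le punctured_minus_cauchy_ell_one fin) auto
      qed (use nonneg in auto)
      finally have H0: "(\<Sum>m\<in>F. \<bar>fconv punctured_kernel F a m\<bar> powr (2 * p)) \<le> G * (X + e * Y)" .
      have "Z \<le> Y / (2 * \<delta>) + \<delta> / 2 * (\<Sum>m\<in>F. \<bar>fconv punctured_kernel F a m\<bar> powr (2 * p))"
        unfolding Z_def Y_def sum_divide_distrib sum_distrib_left sum.distrib[symmetric]
        using pw by (intro sum_mono)
      also have "\<dots> \<le> Y / (2 * \<delta>) + \<delta> / 2 * (G * (X + e * Y))"
        using H0 \<delta> by (intro add_left_mono mult_left_mono) auto
      finally show ?thesis .
    qed
    have XY: "0 \<le> X" "0 \<le> Y" by (auto simp: X_def Y_def intro!: sum_nonneg)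
    have "X \<le> B * (Y / (2 * \<delta>) + \<delta> / 2 * (G * (X + e * Y))) + R * Y"
      using X mult_left_mono[OF Z nonneg(1)] by linarith
    also have "\<dots> = (B / \<delta> * Y) / 2 + (B * G * \<delta>) * ((X + e * Y) / 2) + R * Y"
      by (simp add: algebra_simps)
    \<comment> \<open>\<open>X\<close> returns with a factor of at most 1/2; being a finite sum, it
      can be subtracted from both sides.\<close>
    also have "\<dots> \<le> (B / \<delta> * Y) / 2 + 1 * ((X + e * Y) / 2) + R * Y"
      using \<delta> XY nonneg by (intro add_mono mult_right_mono) auto
    finally have "X \<le> B / \<delta> * Y + e * Y + 2 * (R * Y)" by argo
    then have "X \<le> (B / \<delta> + e + 2 * R) * Y" by (simp only: distrib_right mult.assoc)
    moreover have "(\<Sum>n\<in>S. \<bar>fconv cauchy_kernel F a n\<bar> powr (2 * p)) \<le> X"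
      unfolding X_def using T by (intro sum_mono2) auto
    ultimately show "(\<Sum>n\<in>S. \<bar>fconv cauchy_kernel F a n\<bar> powr (2 * p))
        \<le> (B / \<delta> + e + 2 * R) * (\<Sum>m\<in>F. \<bar>a m\<bar> powr (2 * p))"
      by (simp add: Y_def)
  qed
qed

lemma fconv_cauchy_kernel_bounded_power: "fconv_bounded cauchy_kernel (2 ^ Suc j)"
proof (induction j)
  case 0
  then show ?case using fconv_cauchy_kernel_bounded_2 by simp
next
  case (Suc j)
  have "(1::real) \<le> 2 ^ Suc j" by (rule one_le_power) simp
  from fconv_cauchy_kernel_bounded_double[OF this Suc.IH] show ?case by simp
qed

subsection \<open>Interpolation\<close>

text \<open>A geometric sum is controlled by its largest term, also when exponents are missing. In
  the induction the exponents below the maximum \<open>b\<close> are at most \<open>b - 1\<close>,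
  so the hypothesis applies with the top term times \<open>2 powr - s\<close> as bound.\<close>

lemma sum_powr_two_le:
  assumes "finite G" and s: "0 < s" and "0 \<le> y" and "\<And>k. k \<in> G \<Longrightarrow> 2 powr (real_of_int k * s) \<le> y"
  shows "(\<Sum>k\<in>G. 2 powr (real_of_int k * s)) \<le> y / (1 - 2 powr - s)"
  using assms(1,3,4)
proof (induction G arbitrary: y rule: finite_linorder_max_induct)
  case empty
  have "2 powr - s < 2 powr 0" using s by (intro powr_less_mono) auto
  then show ?case using empty by simp
next
  case (insert b G)
  let ?r = "2 powr - s"
  have r: "?r < 1" using powr_less_mono[of "- s" 0 2] s by simp
  have "2 powr (real_of_int k * s) \<le> 2 powr (real_of_int b * s) * ?r" if "k \<in> G" for k
  proof -
    have "k \<le> b - 1" using insert.hyps(2) that by fastforce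
    then have "real_of_int k * s \<le> (real_of_int b - 1) * s" using s by (intro mult_right_mono) auto
    then have "2 powr (real_of_int k * s) \<le> 2 powr ((real_of_int b - 1) * s)" by simp
    then show ?thesis by (simp add: powr_add[symmetric] algebra_simps)
  qed
  then have "(\<Sum>k\<in>G. 2 powr (real_of_int k * s)) \<le> 2 powr (real_of_int b * s) * ?r / (1 - ?r)"
    by (intro insert.IH) auto
  then have "(\<Sum>k\<in>insert b G. 2 powr (real_of_int k * s))
      \<le> 2 powr (real_of_int b * s) + 2 powr (real_of_int b * s) * ?r / (1 - ?r)"
    using insert.hyps by (subst sum.insert) auto
  also have "\<dots> = 2 powr (real_of_int b * s) / (1 - ?r)"
  proof -
    have "X + X * u / (1 - u) = X / (1 - u)" if "u < 1" for X u :: real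
      using that by (simp add: field_simps)
    then show ?thesis using r .
  qed
  also have "\<dots> \<le> y / (1 - ?r)"
    using r insert.prems by (intro divide_right_mono) auto
  finally show ?case .
qed

text \<open>Marcinkiewicz interpolation; the layer-cake integral is replaced by a sum over dyadic levels.\<close>

lemma fconv_bounded_interpolate:
  assumes p: "1 < p" "p < q" and C: "0 \<le> C"
    and weak: "\<And>F S a t. finite F \<Longrightarrow> finite S \<Longrightarrow> 0 < t \<Longrightarrow> (\<And>n. n \<in> S \<Longrightarrow> t < \<bar>fconv K F a n\<bar>)
      \<Longrightarrow> real (card S) * t \<le> C * (\<Sum>m\<in>F. \<bar>a m\<bar>)"
    and strong: "fconv_bounded K q"
  shows "fconv_bounded K p"
proof -
  obtain A where A: "0 \<le> A" and bound: "\<And>F S a. finite F \<Longrightarrow> finite S \<Longrightarrow>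
     (\<Sum>n\<in>S. \<bar>fconv K F a n\<bar> powr q) \<le> A * (\<Sum>m\<in>F. \<bar>a m\<bar> powr q)"
    using strong unfolding fconv_bounded_def by auto
  \<comment> \<open>\<open>2 powr p\<close> comes from the dyadic factor \<open>2 * ?h k\<close>,
    the factors \<open>2 * C\<close> and \<open>2 powr q * A\<close> from using the weak and strong
    bounds at half height; \<open>d1\<close> and \<open>d2\<close> are sums of geometric
    series.\<close>
  define c1 where "c1 = 2 powr p * (2 * C)"
  define c2 where "c2 = 2 powr p * (2 powr q * A)"
  define d1 where "d1 = 1 / (1 - 2 powr - (p - 1))"
  define d2 where "d2 = 1 / (1 - 2 powr - (q - p))"
  have lt1: "2 powr - s < 1" if "0 < s" for s :: real
    using powr_less_mono[of "- s" 0 2] that by simp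
  have nonneg: "0 \<le> c1" "0 \<le> c2" "0 \<le> d1" "0 \<le> d2"
    using C A lt1[of "p - 1"] lt1[of "q - p"] p by (auto simp: c1_def c2_def d1_def d2_def)
  show ?thesis
    unfolding fconv_bounded_def
  proof (intro exI[of _ "c1 * d1 + c2 * d2"] conjI allI impI)
    show "0 \<le> c1 * d1 + c2 * d2" using nonneg by simp
    fix F S :: "int set" and a :: "int \<Rightarrow> real"
    assume fin: "finite F" "finite S"
    let ?h = "\<lambda>k. 2 powr real_of_int k"
    let ?H = "\<lambda>n. \<bar>fconv K F a n\<bar>"
    define S' where "S' = {n\<in>S. fconv K F a n \<noteq> 0}"
    \<comment> \<open>The index of the dyadic interval, open on the left, that contains the value.
      The ceiling minus 1 keeps the lower inequality strict, as the level sets require; zeros were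
      removed so that the logarithm makes sense.\<close>
    define \<kappa> where "\<kappa> n = \<lceil>log 2 (?H n)\<rceil> - 1" for n
    define G where "G = \<kappa> ` S'"
    have fin': "finite S'" "finite G" using fin by (auto simp: S'_def G_def)
    have kappa: "?h (\<kappa> n) < ?H n" "?H n \<le> 2 * ?h (\<kappa> n)" if "n \<in> S'" for n
    proof -
      have pos: "0 < ?H n" using that by (auto simp: S'_def)
      have "real_of_int (\<kappa> n) < log 2 (?H n)" "log 2 (?H n) \<le> real_of_int (\<kappa> n) + 1"
        unfolding \<kappa>_def by linarith+
      then have "?h (\<kappa> n) < 2 powr log 2 (?H n)" "2 powr log 2 (?H n) \<le> 2 powr (real_of_int (\<kappa> n) + 1)"
        by auto
      then show "?h (\<kappa> n) < ?H n" "?H n \<le> 2 * ?h (\<kappa> n)"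
        using pos by (simp_all add: powr_add)
    qed
    \<comment> \<open>The share of the entry \<open>a m\<close> in level \<open>k\<close>:
      \<open>w1\<close> when it is large and goes through the weak bound, \<open>w2\<close> when it
      is small and goes through the bound at \<open>q\<close>.\<close>
    define w1 where "w1 k m = (if ?h k < \<bar>a m\<bar> then \<bar>a m\<bar> * 2 powr (real_of_int k * (p - 1)) else 0)" for k m
    define w2 where "w2 k m = (if ?h k < \<bar>a m\<bar> then 0 else \<bar>a m\<bar> powr q * 2 powr (real_of_int (- k) * (q - p)))" for k m
    have level: "(2 * ?h k) powr p * card {n\<in>S. ?h k < ?H n} \<le> (\<Sum>m\<in>F. c1 * w1 k m + c2 * w2 k m)" for k
    proof -
      \<comment> \<open>The truncation is cut at the height of the level itself; if the whole sum
        exceeds \<open>?h k\<close>, one of the two pieces exceeds half of it.\<close>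
      let ?F1 = "{m\<in>F. ?h k < \<bar>a m\<bar>}" and ?F2 = "{m\<in>F. \<not> ?h k < \<bar>a m\<bar>}"
      let ?S1 = "{n\<in>S. ?h k / 2 < \<bar>fconv K ?F1 a n\<bar>}" and ?S2 = "{n\<in>S. ?h k / 2 < \<bar>fconv K ?F2 a n\<bar>}"
      have split: "fconv K F a n = fconv K ?F1 a n + fconv K ?F2 a n" for n
        unfolding fconv_def using fin
        by (subst sum.union_disjoint[symmetric]) (auto intro!: sum.cong)
      have "card {n\<in>S. ?h k < ?H n} \<le> card (?S1 \<union> ?S2)"
        using fin by (intro card_mono) (auto simp: split)
      also have "\<dots> \<le> card ?S1 + card ?S2" by (rule card_Un_le)
      finally have card: "real (card {n\<in>S. ?h k < ?H n}) \<le> real (card ?S1) + real (card ?S2)" by simp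
      have "real (card ?S1) * (?h k / 2) \<le> C * (\<Sum>m\<in>?F1. \<bar>a m\<bar>)"
        using fin by (intro weak) auto
      then have S1: "real (card ?S1) \<le> 2 * C * 2 powr - real_of_int k * (\<Sum>m\<in>?F1. \<bar>a m\<bar>)"
        by (simp add: powr_minus field_simps)
      have "real (card ?S2) * (?h k / 2) powr q = (\<Sum>n\<in>?S2. (?h k / 2) powr q)" by simp
      also have "\<dots> \<le> (\<Sum>n\<in>?S2. \<bar>fconv K ?F2 a n\<bar> powr q)"
        using p by (intro sum_mono powr_mono2) auto
      also have "\<dots> \<le> A * (\<Sum>m\<in>?F2. \<bar>a m\<bar> powr q)"
        using fin by (intro bound) auto
      finally have S2: "real (card ?S2) \<le> 2 powr q * A * 2 powr - (real_of_int k * q) * (\<Sum>m\<in>?F2. \<bar>a m\<bar> powr q)"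
        by (simp add: powr_minus powr_divide powr_powr field_simps)
      have "(2 * ?h k) powr p = 2 powr p * 2 powr (real_of_int k * p)"
        by (simp add: powr_mult powr_powr)
      then have "(2 * ?h k) powr p * card {n\<in>S. ?h k < ?H n}
          \<le> 2 powr p * 2 powr (real_of_int k * p) * (2 * C * 2 powr - real_of_int k * (\<Sum>m\<in>?F1. \<bar>a m\<bar>)
            + 2 powr q * A * 2 powr - (real_of_int k * q) * (\<Sum>m\<in>?F2. \<bar>a m\<bar> powr q))"
        using card S1 S2 by (intro mult_mono) auto
      also have "\<dots> = c1 * ((2 powr (real_of_int k * p) * 2 powr - real_of_int k) * (\<Sum>m\<in>?F1. \<bar>a m\<bar>))
          + c2 * ((2 powr (real_of_int k * p) * 2 powr - (real_of_int k * q)) * (\<Sum>m\<in>?F2. \<bar>a m\<bar> powr q))"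
        by (simp add: c1_def c2_def algebra_simps)
      also have "2 powr (real_of_int k * p) * 2 powr - real_of_int k = 2 powr (real_of_int k * (p - 1))"
        by (simp add: powr_add[symmetric] algebra_simps)
      also have "2 powr (real_of_int k * p) * 2 powr - (real_of_int k * q) = 2 powr (real_of_int (- k) * (q - p))"
        by (simp add: powr_add[symmetric] algebra_simps)
      also have "2 powr (real_of_int k * (p - 1)) * (\<Sum>m\<in>?F1. \<bar>a m\<bar>) = (\<Sum>m\<in>F. w1 k m)"
        unfolding w1_def sum_distrib_left using fin
        by (simp add: sum.inter_filter mult.commute)
      also have "2 powr (real_of_int (- k) * (q - p)) * (\<Sum>m\<in>?F2. \<bar>a m\<bar> powr q) = (\<Sum>m\<in>F. w2 k m)"
        unfolding w2_def sum_distrib_left using fin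
        by (subst sum.inter_filter) (auto simp: mult.commute intro!: sum.cong)
      also have "c1 * (\<Sum>m\<in>F. w1 k m) + c2 * (\<Sum>m\<in>F. w2 k m) = (\<Sum>m\<in>F. c1 * w1 k m + c2 * w2 k m)"
        by (simp only: sum_distrib_left sum.distrib)
      finally show ?thesis .
    qed
    have w1: "(\<Sum>k\<in>G. w1 k m) \<le> d1 * \<bar>a m\<bar> powr p" for m
    proof (cases "a m = 0")
      case True
      then show ?thesis by (simp add: w1_def)
    next
      case False
      have "(\<Sum>k\<in>G. w1 k m) = \<bar>a m\<bar> * (\<Sum>k\<in>{k\<in>G. ?h k < \<bar>a m\<bar>}. 2 powr (real_of_int k * (p - 1)))"
        unfolding w1_def sum_distrib_left using fin' by (simp add: sum.inter_filter)
      also have "\<dots> \<le> \<bar>a m\<bar> * (\<bar>a m\<bar> powr (p - 1) / (1 - 2 powr - (p - 1)))"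
      proof (intro mult_left_mono sum_powr_two_le)
        fix k assume "k \<in> {k\<in>G. ?h k < \<bar>a m\<bar>}"
        then have "(?h k) powr (p - 1) \<le> \<bar>a m\<bar> powr (p - 1)"
          using p by (intro powr_mono2) auto
        then show "2 powr (real_of_int k * (p - 1)) \<le> \<bar>a m\<bar> powr (p - 1)" by (simp add: powr_powr)
      qed (use p fin' in auto)
      also have "\<dots> = d1 * (\<bar>a m\<bar> powr 1 * \<bar>a m\<bar> powr (p - 1))" by (simp add: d1_def)
      also have "\<bar>a m\<bar> powr 1 * \<bar>a m\<bar> powr (p - 1) = \<bar>a m\<bar> powr p"
        by (subst powr_add[symmetric]) simp
      finally show ?thesis .
    qed
    have w2: "(\<Sum>k\<in>G. w2 k m) \<le> d2 * \<bar>a m\<bar> powr p" for m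
    proof (cases "a m = 0")
      case True
      then show ?thesis by (simp add: w2_def)
    next
      case False
      \<comment> \<open>The small-entry weights decay as \<open>k\<close> grows. Reflecting the
        levels turns them into an increasing geometric sum, as \<open>sum_powr_two_le\<close>
        expects.\<close>
      let ?G = "uminus ` {k\<in>G. \<not> ?h k < \<bar>a m\<bar>}"
      have "(\<Sum>k\<in>G. w2 k m)
          = \<bar>a m\<bar> powr q * (\<Sum>k\<in>{k\<in>G. \<not> ?h k < \<bar>a m\<bar>}. 2 powr (real_of_int (- k) * (q - p)))"
        unfolding w2_def sum_distrib_left using fin'
        by (subst sum.inter_filter) (auto intro!: sum.cong)
      also have "(\<Sum>k\<in>{k\<in>G. \<not> ?h k < \<bar>a m\<bar>}. 2 powr (real_of_int (- k) * (q - p)))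
          = (\<Sum>k\<in>?G. 2 powr (real_of_int k * (q - p)))"
        by (subst sum.reindex) (auto simp: inj_on_def)
      also have "\<bar>a m\<bar> powr q * \<dots> \<le> \<bar>a m\<bar> powr q * (\<bar>a m\<bar> powr (- (q - p)) / (1 - 2 powr - (q - p)))"
      proof (intro mult_left_mono sum_powr_two_le)
        fix k assume "k \<in> ?G"
        then have "\<bar>a m\<bar> \<le> ?h (- k)" by auto
        then have "(?h (- k)) powr (- (q - p)) \<le> \<bar>a m\<bar> powr (- (q - p))"
          using p False by (intro powr_mono2') auto
        moreover have "real_of_int (- k) * (- (q - p)) = real_of_int k * (q - p)" by (simp add: algebra_simps)
        ultimately show "2 powr (real_of_int k * (q - p)) \<le> \<bar>a m\<bar> powr (- (q - p))"
          by (simp only: powr_powr)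
      qed (use p fin' in auto)
      also have "\<dots> = d2 * (\<bar>a m\<bar> powr q * \<bar>a m\<bar> powr (- (q - p)))" by (simp add: d2_def)
      also have "\<bar>a m\<bar> powr q * \<bar>a m\<bar> powr (- (q - p)) = \<bar>a m\<bar> powr p"
        by (subst powr_add[symmetric]) simp
      finally show ?thesis .
    qed
    have "(\<Sum>n\<in>S. ?H n powr p) = (\<Sum>n\<in>S'. ?H n powr p)"
      using fin by (intro sum.mono_neutral_right) (auto simp: S'_def)
    \<comment> \<open>The single level \<open>\<kappa> n\<close> already pays for the value at
      \<open>n\<close>; the other levels only add nonnegative terms. Exchanging the sums then counts
      level sets.\<close>
    also have "\<dots> \<le> (\<Sum>n\<in>S'. \<Sum>k\<in>G. if ?h k < ?H n then (2 * ?h k) powr p else 0)"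
    proof (rule sum_mono)
      fix n assume n: "n \<in> S'"
      have "?H n powr p \<le> (2 * ?h (\<kappa> n)) powr p"
        using kappa[OF n] p by (intro powr_mono2) auto
      also have "\<dots> = (\<Sum>k\<in>{\<kappa> n}. if ?h k < ?H n then (2 * ?h k) powr p else 0)"
        using kappa[OF n] by simp
      also have "\<dots> \<le> (\<Sum>k\<in>G. if ?h k < ?H n then (2 * ?h k) powr p else 0)"
        using n fin' by (intro sum_mono2) (auto simp: G_def)
      finally show "?H n powr p \<le> (\<Sum>k\<in>G. if ?h k < ?H n then (2 * ?h k) powr p else 0)" .
    qed
    also have "\<dots> \<le> (\<Sum>n\<in>S. \<Sum>k\<in>G. if ?h k < ?H n then (2 * ?h k) powr p else 0)"
      using fin by (intro sum_mono2) (auto simp: S'_def intro!: sum_nonneg)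
    also have "\<dots> = (\<Sum>k\<in>G. (2 * ?h k) powr p * card {n\<in>S. ?h k < ?H n})"
      using fin by (subst sum.swap) (simp add: sum.If_cases Int_def mult.commute)
    also have "\<dots> \<le> (\<Sum>k\<in>G. \<Sum>m\<in>F. c1 * w1 k m + c2 * w2 k m)"
      by (intro sum_mono level)
    also have "\<dots> = (\<Sum>m\<in>F. c1 * (\<Sum>k\<in>G. w1 k m) + c2 * (\<Sum>k\<in>G. w2 k m))"
      by (subst sum.swap) (simp only: sum_distrib_left sum.distrib)
    also have "\<dots> \<le> (\<Sum>m\<in>F. c1 * (d1 * \<bar>a m\<bar> powr p) + c2 * (d2 * \<bar>a m\<bar> powr p))"
      using w1 w2 nonneg by (intro sum_mono add_mono mult_left_mono)
    also have "\<dots> = (c1 * d1 + c2 * d2) * (\<Sum>m\<in>F. \<bar>a m\<bar> powr p)"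
      by (simp only: sum_distrib_left distrib_right mult.assoc sum.distrib)
    finally show "(\<Sum>n\<in>S. ?H n powr p) \<le> (c1 * d1 + c2 * d2) * (\<Sum>m\<in>F. \<bar>a m\<bar> powr p)" .
  qed
qed

lemma fconv_cauchy_kernel_bounded:
  assumes "1 < p"
  shows "fconv_bounded cauchy_kernel p"
proof -
  obtain j where "p < 2 ^ j" using real_arch_pow[of 2 p] by auto
  \<comment> \<open>The exponent is raised once more to match
    \<open>fconv_cauchy_kernel_bounded_power\<close>, whose exponents start at 2.\<close>
  then have "p < 2 ^ Suc j" using assms by simp
  then show ?thesis
    by (rule fconv_bounded_interpolate[where C = 8, OF assms])
       (simp, rule card_fconv_cauchy_kernel, assumption+, rule fconv_cauchy_kernel_bounded_power)
qed

subsection \<open>Decay of \<open>D\<close>\<close>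

text \<open>With \<open>s = sin (\<theta> / 2)\<close> and \<open>w = sqrt (1 + s^2)\<close> the
  discriminant is the square of \<open>2 * s * w\<close>, and \<open>rho \<theta>\<close> is the
  square of \<open>w - s\<close>. The resulting formula is smooth, so it can be differentiated up to
  the endpoints.\<close>

lemma sqrt_rho:
  assumes "0 \<le> \<theta>" "\<theta> \<le> pi"
  shows "sqrt (rho \<theta>) = sqrt (1 + (sin (\<theta> / 2))\<^sup>2) - sin (\<theta> / 2)"
proof -
  define s where "s = sin (\<theta> / 2)"
  define w where "w = sqrt (1 + s\<^sup>2)"
  have s: "0 \<le> s" unfolding s_def using assms by (intro sin_ge_zero) auto
  have w2: "w\<^sup>2 = 1 + s\<^sup>2" by (simp add: w_def)
  have ws: "s \<le> w" unfolding w_def by (rule real_le_rsqrt) simp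
  have w: "0 \<le> w" using s ws by simp
  have c: "cos \<theta> = 1 - 2 * s\<^sup>2"
    using cos_double_sin[of "\<theta> / 2"] by (simp add: s_def)
  have "(2 - cos \<theta>)\<^sup>2 - 1 = 4 * s\<^sup>2 * (1 + s\<^sup>2)"
    unfolding c by (simp add: power2_eq_square algebra_simps)
  also have "\<dots> = (2 * s * w)\<^sup>2" by (simp add: power_mult_distrib w2)
  finally have "sqrt ((2 - cos \<theta>)\<^sup>2 - 1) = 2 * s * w" using s w by simp
  then have "rho \<theta> = (w - s)\<^sup>2"
    unfolding rho_def c power2_diff w2 by (simp add: algebra_simps)
  then show ?thesis using ws by (simp add: w_def s_def)
qed

text \<open>Write \<open>N = n + 1/2\<close> and \<open>g\<close> for the square root of
  \<open>rho\<close>. Integrating by parts twice, the boundary value \<open>g 0 = 1\<close> produces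
  \<open>1 / N\<close>, which is exactly the contribution of \<open>K_Hplus\<close>. What remains is
  \<open>1 / N^2\<close> times an integral of the second derivative.\<close>

lemma D_decay: "\<bar>D n\<bar> \<le> 1 / (real_of_int n + 1/2)\<^sup>2"
proof -
  define N where "N = real_of_int n + 1/2"
  have N: "N \<noteq> 0" unfolding N_def by (rule half_shift_neq_0)
  define w where "w x = sqrt (1 + (sin (x / 2))\<^sup>2)" for x :: real
  define g where "g x = w x - sin (x / 2)" for x
  \<comment> \<open>\<open>g1\<close> and \<open>g2\<close> are the first and second derivatives of
    \<open>g\<close>.\<close>
  define g1 where "g1 x = sin (x / 2) * cos (x / 2) / (2 * w x) - cos (x / 2) / 2" for x
  define g2 where "g2 x = ((cos (x / 2))\<^sup>2 - (sin (x / 2))\<^sup>2) / (4 * w x)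
      - (sin (x / 2) * cos (x / 2))\<^sup>2 / (4 * w x ^ 3) + sin (x / 2) / 4" for x
  have w1: "1 \<le> w x" for x by (simp add: w_def)
  have w0: "w x \<noteq> 0" for x using w1[of x] by simp
  have w_deriv: "(w has_real_derivative sin (x / 2) * cos (x / 2) / (2 * w x)) (at x)" for x
  proof -
    have pos: "0 < 1 + (sin (x / 2))\<^sup>2" by (simp add: add_pos_nonneg)
    have "((\<lambda>x. 1 + (sin (x / 2))\<^sup>2) has_real_derivative sin (x / 2) * cos (x / 2)) (at x)"
      by (auto intro!: derivative_eq_intros)
    from DERIV_chain2[OF DERIV_real_sqrt[OF pos] this] show ?thesis
      unfolding w_def[abs_def] by (simp add: inverse_eq_divide mult.commute)
  qed
  have g_deriv: "(g has_real_derivative g1 x) (at x)" for x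
  proof -
    have "((\<lambda>x. sin (x / 2)) has_real_derivative cos (x / 2) / 2) (at x)"
      by (auto intro!: derivative_eq_intros)
    from DERIV_diff[OF w_deriv this] show ?thesis unfolding g_def[abs_def] g1_def .
  qed
  have g1_deriv: "(g1 has_real_derivative g2 x) (at x)" for x
  proof -
    have sc: "((\<lambda>x. sin (x / 2) * cos (x / 2)) has_real_derivative
        (cos (x / 2) / 2) * cos (x / 2) + sin (x / 2) * (- (sin (x / 2) / 2))) (at x)"
      by (auto intro!: derivative_eq_intros)
    have c: "((\<lambda>x. cos (x / 2) / 2) has_real_derivative - (sin (x / 2) / 2 / 2)) (at x)"
      by (auto intro!: derivative_eq_intros)
    have "2 * w x \<noteq> 0" using w0 by simp
    from DERIV_diff[OF DERIV_divide[OF sc DERIV_cmult[OF w_deriv] this] c]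
    have "(g1 has_real_derivative
        (((cos (x / 2) / 2) * cos (x / 2) + sin (x / 2) * (- (sin (x / 2) / 2))) * (2 * w x)
          - sin (x / 2) * cos (x / 2) * (2 * (sin (x / 2) * cos (x / 2) / (2 * w x)))) / (2 * w x * (2 * w x))
        + sin (x / 2) / 2 / 2) (at x)"
      unfolding g1_def[abs_def] by simp
    also have "(((cos (x / 2) / 2) * cos (x / 2) + sin (x / 2) * (- (sin (x / 2) / 2))) * (2 * w x)
          - sin (x / 2) * cos (x / 2) * (2 * (sin (x / 2) * cos (x / 2) / (2 * w x)))) / (2 * w x * (2 * w x))
        + sin (x / 2) / 2 / 2 = g2 x"
    proof -
      have "((c / 2 * c + s * (- (s / 2))) * (2 * v) - s * c * (2 * (s * c / (2 * v)))) / (2 * v * (2 * v))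
          + s / 2 / 2 = (c\<^sup>2 - s\<^sup>2) / (4 * v) - (s * c)\<^sup>2 / (4 * v ^ 3) + s / 4"
        if "v \<noteq> 0" for s c v :: real
        using that by (simp add: power2_eq_square power3_eq_cube field_simps)
      then show ?thesis unfolding g2_def using w0 .
    qed
    finally show ?thesis .
  qed
  \<comment> \<open>Each of the three terms of \<open>g2\<close> is at most 1/4 in modulus, since
    \<open>w\<close> is at least 1.\<close>
  have g2_le: "\<bar>g2 x\<bar> \<le> 1" for x
  proof -
    have s: "\<bar>sin (x / 2)\<bar> \<le> 1" "(sin (x / 2))\<^sup>2 \<le> 1" "(cos (x / 2))\<^sup>2 \<le> 1"
      by (auto simp: abs_square_le_1)
    have div: "\<bar>u / (4 * v)\<bar> \<le> 1 / 4" if "\<bar>u\<bar> \<le> 1" "1 \<le> v" for u v :: real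
      using that by (simp add: abs_divide divide_le_eq)
    have "\<bar>((cos (x / 2))\<^sup>2 - (sin (x / 2))\<^sup>2) / (4 * w x)\<bar> \<le> 1 / 4"
      using s w1[of x] zero_le_power2[of "sin (x/2)"] zero_le_power2[of "cos (x/2)"]
      by (intro div) linarith+
    moreover have "\<bar>(sin (x / 2) * cos (x / 2))\<^sup>2 / (4 * w x ^ 3)\<bar> \<le> 1 / 4"
    proof (rule div)
      show "\<bar>(sin (x / 2) * cos (x / 2))\<^sup>2\<bar> \<le> 1"
        using s mult_mono[of "(sin (x / 2))\<^sup>2" 1 "(cos (x / 2))\<^sup>2" 1]
        by (simp add: power_mult_distrib)
      show "1 \<le> w x ^ 3" using w1 by (rule one_le_power)
    qed
    ultimately show ?thesis using s(1) unfolding g2_def by linarith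
  qed
  have g2_cont: "continuous_on {0..pi} g2"
    unfolding g2_def[abs_def] w_def using w0 by (intro continuous_intros) (auto simp: w_def)
  \<comment> \<open>\<open>N * pi\<close> is an odd multiple of \<open>pi / 2\<close>.\<close>
  have cosN: "cos (N * pi) = 0"
    unfolding cos_zero_iff_int2 N_def by (intro exI[of _ n]) (simp add: algebra_simps)
  text \<open>Two integrations by parts at once; all boundary terms except the one giving
    \<open>1 / N\<close> vanish because \<open>cos (N * pi) = 0\<close> and \<open>g1 pi = 0\<close>.\<close>
  have ibp: "((\<lambda>x. g x * sin (N * x) + g2 x * sin (N * x) / N\<^sup>2) has_integral 1 / N) {0..pi}"
  proof -
    let ?P = "\<lambda>x. - g x * cos (N * x) / N + g1 x * sin (N * x) / N\<^sup>2"
    have "(?P has_real_derivative g x * sin (N * x) + g2 x * sin (N * x) / N\<^sup>2) (at x)" for x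
    proof -
      have trig: "((\<lambda>x. cos (N * x)) has_real_derivative - (sin (N * x) * N)) (at x)"
        "((\<lambda>x. sin (N * x)) has_real_derivative cos (N * x) * N) (at x)"
        by (auto intro!: derivative_eq_intros)
      have "(?P has_real_derivative (- g1 x * cos (N * x) + - (sin (N * x) * N) * - g x) / N
          + (g2 x * sin (N * x) + cos (N * x) * N * g1 x) / N\<^sup>2) (at x)"
        by (intro DERIV_add DERIV_cdivide DERIV_mult DERIV_minus g_deriv g1_deriv trig)
      also have "(- g1 x * cos (N * x) + - (sin (N * x) * N) * - g x) / N
          + (g2 x * sin (N * x) + cos (N * x) * N * g1 x) / N\<^sup>2
          = g x * sin (N * x) + g2 x * sin (N * x) / N\<^sup>2"
        using N by (simp add: power2_eq_square field_simps)
      finally show ?thesis .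
    qed
    then have "((\<lambda>x. g x * sin (N * x) + g2 x * sin (N * x) / N\<^sup>2) has_integral ?P pi - ?P 0) {0..pi}"
      by (intro fundamental_theorem_of_calculus)
         (auto intro: has_field_derivative_at_within simp flip: has_real_derivative_iff_has_vector_derivative)
    moreover have "?P pi - ?P 0 = 1 / N"
      by (simp add: cosN g1_def g_def w_def)
    ultimately show ?thesis by simp
  qed
  have int2: "(\<lambda>x. g2 x * sin (N * x)) integrable_on {0..pi}"
    by (intro integrable_continuous_real continuous_intros g2_cont)
  define J where "J = integral {0..pi} (\<lambda>x. g2 x * sin (N * x))"
  have J: "\<bar>J\<bar> \<le> pi"
  proof -
    have "norm (integral {0..pi} (\<lambda>x. g2 x * sin (N * x))) \<le> 1 * (pi - 0)"
    proof (rule integral_bound)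
      show "continuous_on {0..pi} (\<lambda>x. g2 x * sin (N * x))"
        by (intro continuous_intros g2_cont)
      have "norm (g2 x * sin (N * x)) \<le> 1" for x
        using mult_mono[OF g2_le[of x] abs_sin_le_one[of "N * x"]] by (simp add: abs_mult)
      then show "norm (g2 x * sin (N * x)) \<le> 1" if "x \<in> {0..pi}" for x .
    qed simp
    then show ?thesis by (simp add: J_def)
  qed
  have "((\<lambda>x. g2 x * sin (N * x) / N\<^sup>2) has_integral J / N\<^sup>2) {0..pi}"
    unfolding J_def using int2 by (intro has_integral_divide integrable_integral)
  from has_integral_diff[OF ibp this]
  have "((\<lambda>x. g x * sin (N * x)) has_integral 1 / N - J / N\<^sup>2) {0..pi}" by simp
  then have "((\<lambda>\<theta>. sqrt (rho \<theta>) * sin (N * \<theta>)) has_integral 1 / N - J / N\<^sup>2) {0..pi}"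
    by (rule has_integral_eq[rotated]) (auto simp: sqrt_rho g_def w_def)
  then have "integral {0..pi} (\<lambda>\<theta>. sqrt (rho \<theta>) * sin (N * \<theta>)) = 1 / N - J / N\<^sup>2"
    by (rule integral_unique)
  then have Dn: "D n = - (J / pi) / N\<^sup>2"
    unfolding D_def K_d_def K_Hplus_def N_def[symmetric] by (simp add: field_simps)
  have "\<bar>J / pi\<bar> \<le> 1" using J by (simp add: abs_divide divide_le_eq)
  then have "\<bar>- (J / pi)\<bar> / N\<^sup>2 \<le> 1 / N\<^sup>2" by (intro divide_right_mono) auto
  then have "\<bar>D n\<bar> \<le> 1 / N\<^sup>2" unfolding Dn abs_divide[of "- (J / pi)"] by simp
  then show ?thesis by (simp only: N_def)
qed

lemma D_ell_one: "D \<in> ell 1"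
  using D_decay by (rule ell_one_of_quadratic_decay)

subsection \<open>Passage to infinite sequences\<close>

text \<open>Finiteness has to be proved first, because \<open>card\<close> of an infinite set is 0.
  It follows from a common bound on the cardinalities of all finite subsets.\<close>

lemma card_le_of_finite_subsets:
  fixes t B :: real
  assumes "0 < t" and "\<And>S. finite S \<Longrightarrow> S \<subseteq> X \<Longrightarrow> card S * t \<le> B"
  shows "finite X \<and> card X \<le> B / t"
proof -
  have "card S \<le> nat \<lfloor>B / t\<rfloor>" if "S \<subseteq> X" "finite S" for S
  proof -
    have "real (card S) \<le> B / t" using assms(1) assms(2)[OF that(2,1)] by (simp add: pos_le_divide_eq)
    then show ?thesis by linarith
  qed
  then have "finite X" using finite_if_finite_subsets_card_bdd by blast
  then show ?thesis using assms(1) assms(2)[of X] by (simp add: pos_le_divide_eq)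
qed

section \<open>The norm of \<open>ell p\<close> and Minkowski's inequality\<close>

lemma powr_ell_norm:
  assumes "p \<noteq> 0"
  shows "ell_norm p a powr p = (\<Sum>\<^sub>\<infinity>n. norm (a n) powr p)"
  using assms by (simp add: ell_norm_def powr_powr infsum_nonneg)

lemma sum_powr_le_ell_norm:
  assumes "1 \<le> p" "a \<in> ell p" "finite F"
  shows "(\<Sum>m\<in>F. norm (a m) powr p) \<le> ell_norm p a powr p"
  using assms by (subst powr_ell_norm) (auto simp: ell_def intro!: finite_sum_le_infsum)

lemma norm_le_ell_norm:
  assumes "1 \<le> p" "a \<in> ell p"
  shows "norm (a m) \<le> ell_norm p a"
proof -
  have "norm (a m) powr p \<le> ell_norm p a powr p"
    using sum_powr_le_ell_norm[OF assms, of "{m}"] by simp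
  then show ?thesis
    using powr_less_mono2[of p "ell_norm p a" "norm (a m)"] assms(1) ell_norm_nonneg[of p a] by linarith
qed

text \<open>The route by which estimates on finite sets become membership together with a norm
  bound, without loss of constant.\<close>

lemma ellI:
  assumes p: "1 \<le> p" and B: "0 \<le> B"
    and bd: "\<And>S. finite S \<Longrightarrow> (\<Sum>n\<in>S. norm (a n) powr p) \<le> B powr p"
  shows "a \<in> ell p \<and> ell_norm p a \<le> B"
proof -
  have summ: "(\<lambda>n. norm (a n) powr p) summable_on UNIV"
    by (intro nonneg_bdd_above_summable_on bdd_aboveI2[where M = "B powr p"]) (auto intro: bd)
  then have "(\<Sum>\<^sub>\<infinity>n. norm (a n) powr p) \<le> B powr p"
    by (intro infsum_le_finite_sums) (auto intro: bd)
  then have "ell_norm p a \<le> (B powr p) powr (1 / p)"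
    unfolding ell_norm_def using p by (intro powr_mono2) (auto intro: infsum_nonneg)
  then show ?thesis using p B summ by (simp add: powr_powr ell_def)
qed

text \<open>After division by the sum of the norms, \<open>norm (a n) + norm (b n)\<close> is a
  convex combination of the normalised entries, and convexity of the power applies term by
  term.\<close>

lemma minkowski_ell:
  fixes a b :: "int \<Rightarrow> 'a::real_normed_vector"
  assumes p: "1 \<le> p" and a: "a \<in> ell p" and b: "b \<in> ell p"
  shows "(\<lambda>n. a n + b n) \<in> ell p \<and> ell_norm p (\<lambda>n. a n + b n) \<le> ell_norm p a + ell_norm p b"
proof (rule ellI[OF p])
  let ?u = "ell_norm p a" and ?v = "ell_norm p b"
  show uv: "0 \<le> ?u + ?v" by (simp add: ell_norm_nonneg)
  fix S :: "int set"
  assume S: "finite S"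
  \<comment> \<open>The normalisation divides by both norms, so a sequence of norm 0, which vanishes
    identically, is treated apart.\<close>
  consider "?u = 0" | "?v = 0" | "0 < ?u" "0 < ?v"
    using ell_norm_nonneg[of p a] ell_norm_nonneg[of p b] by linarith
  then show "(\<Sum>n\<in>S. norm (a n + b n) powr p) \<le> (?u + ?v) powr p"
  proof cases
    case 1
    then have "a n = 0" for n using norm_le_ell_norm[OF p a, of n] by simp
    then show ?thesis using sum_powr_le_ell_norm[OF p b S] 1 by simp
  next
    case 2
    then have "b n = 0" for n using norm_le_ell_norm[OF p b, of n] by simp
    then show ?thesis using sum_powr_le_ell_norm[OF p a S] 2 by simp
  next
    case 3
    let ?s = "?u + ?v"
    have s: "0 < ?s" using 3 by simp
    have "norm (a n + b n) powr p
        \<le> ?s powr p * (?u / ?s * (norm (a n) powr p / ?u powr p) + ?v / ?s * (norm (b n) powr p / ?v powr p))" for n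
    proof -
      have "norm (a n + b n) powr p \<le> (norm (a n) + norm (b n)) powr p"
        using p norm_triangle_ineq by (intro powr_mono2) auto
      also have "norm (a n) + norm (b n) = ?s * (?u / ?s * (norm (a n) / ?u) + ?v / ?s * (norm (b n) / ?v))"
        using 3 s by (simp add: distrib_left)
      also have "\<dots> powr p = ?s powr p * (?u / ?s * (norm (a n) / ?u) + ?v / ?s * (norm (b n) / ?v)) powr p"
        by (rule powr_mult)
      also have "(?u / ?s * (norm (a n) / ?u) + ?v / ?s * (norm (b n) / ?v)) powr p
          \<le> ?u / ?s * (norm (a n) / ?u) powr p + ?v / ?s * (norm (b n) / ?v) powr p"
      proof -
        have "1 - ?v / ?s = ?u / ?s" using s by (simp add: field_simps)
        then show ?thesis
          using convex_onD[OF powr_convex_nonneg[OF p], of "?v / ?s" "norm (a n) / ?u" "norm (b n) / ?v"] 3 s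
          by simp
      qed
      finally show ?thesis using 3 by (simp add: powr_divide)
    qed
    then have "(\<Sum>n\<in>S. norm (a n + b n) powr p)
        \<le> (\<Sum>n\<in>S. ?s powr p * (?u / ?s * (norm (a n) powr p / ?u powr p) + ?v / ?s * (norm (b n) powr p / ?v powr p)))"
      by (intro sum_mono)
    also have "\<dots> = ?s powr p * (?u / ?s * ((\<Sum>n\<in>S. norm (a n) powr p) / ?u powr p)
        + ?v / ?s * ((\<Sum>n\<in>S. norm (b n) powr p) / ?v powr p))"
      by (simp only: sum_distrib_left[symmetric] sum.distrib sum_divide_distrib[symmetric])
    also have "\<dots> \<le> ?s powr p * (?u / ?s * 1 + ?v / ?s * 1)"
      using sum_powr_le_ell_norm[OF p a S] sum_powr_le_ell_norm[OF p b S] 3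
      by (intro mult_left_mono add_mono) auto
    also have "\<dots> = ?s powr p" using s by (simp add: add_divide_distrib[symmetric])
    finally show ?thesis .
  qed
qed

section \<open>Convergence of the convolution series\<close>

lemma summable_on_int_reflect:
  fixes f :: "int \<Rightarrow> real"
  assumes "f summable_on UNIV"
  shows "(\<lambda>m. f (n - m)) summable_on UNIV"
proof -
  have "bij_betw (\<lambda>m. n - m) UNIV (UNIV :: int set)"
    by (rule bij_betw_byWitness[where f' = "\<lambda>m. n - m"]) auto
  then show ?thesis using summable_on_reindex_bij_betw[of "\<lambda>m. n - m" UNIV UNIV f] assms by simp
qed

lemma convolvable_ell_one_kernel:
  fixes a :: "int \<Rightarrow> complex"
  assumes p: "1 \<le> p" and K: "K \<in> ell 1" and a: "a \<in> ell p"
  shows "convolvable K a"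
  unfolding convolvable_def
proof
  fix n
  have "(\<lambda>m. norm (K (n - m)) * ell_norm p a) summable_on UNIV"
    using K by (intro summable_on_cmult_left summable_on_int_reflect) (simp add: ell_one_iff)
  moreover have "norm (complex_of_real (K (n - m)) * a m) \<le> norm (K (n - m)) * ell_norm p a" for m
    unfolding norm_mult norm_of_real real_norm_def by (intro mult_left_mono norm_le_ell_norm p a) simp
  ultimately have "(\<lambda>m. norm (complex_of_real (K (n - m)) * a m)) summable_on UNIV"
    by (intro Infinite_Sum.abs_summable_on_comparison_test'[where g = "\<lambda>m. norm (K (n - m)) * ell_norm p a"])
  then show "(\<lambda>m. complex_of_real (K (n - m)) * a m) summable_on UNIV"
    by (rule abs_summable_summable)
qed

lemma K_Hplus_eq: "K_Hplus n = cauchy_kernel n / pi"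
  by (simp add: K_Hplus_def cauchy_kernel_def)

lemma abs_K_Hplus_le: "\<bar>K_Hplus n\<bar> \<le> \<bar>cauchy_kernel n\<bar>"
proof -
  have "\<bar>cauchy_kernel n\<bar> / pi \<le> \<bar>cauchy_kernel n\<bar> / 1"
    using pi_ge_two by (intro divide_left_mono) auto
  then show ?thesis by (simp add: K_Hplus_eq abs_divide)
qed

text \<open>The kernel is not summable, but it is bounded, which suffices for \<open>p = 1\<close>,
  and its powers with exponent above 1 are summable. For \<open>p > 1\<close> Young's inequality for
  products with the conjugate exponent \<open>q\<close> supplies the dominating family.\<close>

lemma convolvable_K_Hplus:
  fixes a :: "int \<Rightarrow> complex"
  assumes p: "1 \<le> p" and a: "a \<in> ell p"
  shows "convolvable K_Hplus a"
  unfolding convolvable_def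
proof
  fix n
  have a': "(\<lambda>m. norm (a m) powr p) summable_on UNIV" using a by (simp add: ell_def)
  have "(\<lambda>m. \<bar>cauchy_kernel (n - m)\<bar> * norm (a m)) summable_on UNIV"
  proof (cases "p = 1")
    case True
    have le2: "\<bar>cauchy_kernel j\<bar> \<le> 2" for j
    proof -
      have "\<bar>cauchy_kernel j\<bar> \<le> 1 / (1/2)"
        unfolding cauchy_kernel_def abs_divide abs_one by (rule frac_le[OF _ _ _ abs_half_shift_ge]) simp_all
      then show ?thesis by simp
    qed
    have "(\<lambda>m. 2 * norm (a m)) summable_on UNIV"
      using a' True by (intro summable_on_cmult_right) simp
    then show ?thesis
      by (rule summable_on_comparison_test) (intro mult_right_mono le2 mult_nonneg_nonneg, simp_all)
  next
    case False
    then have p1: "1 < p" using p by simp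
    define q where "q = p / (p - 1)"
    have q: "1 < q" "1 / p + 1 / q = 1" using p1 by (auto simp: q_def field_simps)
    have "(\<lambda>j. \<bar>cauchy_kernel j\<bar> powr q) summable_on UNIV"
    proof -
      have "\<bar>cauchy_kernel j\<bar> powr q = \<bar>real_of_int j + 1/2\<bar> powr - q" for j
        by (simp only: cauchy_kernel_def abs_divide abs_one powr_divide powr_one_eq_one powr_minus_divide abs_ge_zero)
      then show ?thesis using summable_half_shift_powr[OF q(1)] by (simp only:)
    qed
    then have "(\<lambda>m. \<bar>cauchy_kernel (n - m)\<bar> powr q * (1 / q)) summable_on UNIV"
      by (intro summable_on_cmult_left summable_on_int_reflect)
    moreover have "(\<lambda>m. norm (a m) powr p * (1 / p)) summable_on UNIV"
      by (intro summable_on_cmult_left a')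
    ultimately have "(\<lambda>m. norm (a m) powr p * (1 / p) + \<bar>cauchy_kernel (n - m)\<bar> powr q * (1 / q)) summable_on UNIV"
      by (intro summable_on_add)
    then show ?thesis
    proof (rule summable_on_comparison_test)
      fix m
      show "\<bar>cauchy_kernel (n - m)\<bar> * norm (a m)
          \<le> norm (a m) powr p * (1 / p) + \<bar>cauchy_kernel (n - m)\<bar> powr q * (1 / q)"
        using Youngs_inequality[OF p1 q, of "norm (a m)" "\<bar>cauchy_kernel (n - m)\<bar>"]
        by (simp add: mult.commute)
    qed auto
  qed
  moreover have "norm (complex_of_real (K_Hplus (n - m)) * a m) \<le> \<bar>cauchy_kernel (n - m)\<bar> * norm (a m)" for m
    unfolding norm_mult norm_of_real by (intro mult_right_mono abs_K_Hplus_le) simp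
  ultimately have "(\<lambda>m. norm (complex_of_real (K_Hplus (n - m)) * a m)) summable_on UNIV"
    by (intro Infinite_Sum.abs_summable_on_comparison_test'[where g = "\<lambda>m. \<bar>cauchy_kernel (n - m)\<bar> * norm (a m)"])
  then show "(\<lambda>m. complex_of_real (K_Hplus (n - m)) * a m) summable_on UNIV"
    by (rule abs_summable_summable)
qed

lemma convolvable_tendsto:
  assumes "convolvable K a"
  shows "((\<lambda>F. \<Sum>m\<in>F. complex_of_real (K (n - m)) * a m) \<longlongrightarrow> conv K a n) (finite_subsets_at_top UNIV)"
  using assms unfolding convolvable_def conv_def by (intro infsum_tendsto) auto

text \<open>With \<open>S\<close> fixed, the truncation \<open>F\<close> exhausts the integers; the
  finite sum over \<open>S\<close> passes to the limit and keeps the constant \<open>B\<close>. Only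
  then does \<open>S\<close> vary.\<close>

lemma conv_ell_of_finite:
  assumes p: "1 \<le> p" and B: "0 \<le> B" and a: "a \<in> ell p" and conv: "convolvable K a"
    and bd: "\<And>F S. finite F \<Longrightarrow> finite S \<Longrightarrow>
      (\<Sum>n\<in>S. cmod (\<Sum>m\<in>F. complex_of_real (K (n - m)) * a m) powr p) \<le> B powr p * (\<Sum>m\<in>F. cmod (a m) powr p)"
  shows "conv K a \<in> ell p \<and> ell_norm p (conv K a) \<le> B * ell_norm p a"
proof (rule ellI[OF p])
  show "0 \<le> B * ell_norm p a" using B by (simp add: ell_norm_nonneg)
  fix S :: "int set"
  assume S: "finite S"
  have "((\<lambda>F. \<Sum>n\<in>S. cmod (\<Sum>m\<in>F. complex_of_real (K (n - m)) * a m) powr p)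
      \<longlongrightarrow> (\<Sum>n\<in>S. cmod (conv K a n) powr p)) (finite_subsets_at_top UNIV)"
    using p by (intro tendsto_sum tendsto_powr' tendsto_norm tendsto_const convolvable_tendsto[OF conv]) auto
  then show "(\<Sum>n\<in>S. cmod (conv K a n) powr p) \<le> (B * ell_norm p a) powr p"
  proof (rule tendsto_upperbound)
    have "(\<Sum>n\<in>S. cmod (\<Sum>m\<in>F. complex_of_real (K (n - m)) * a m) powr p) \<le> (B * ell_norm p a) powr p"
      if "finite F" for F
    proof -
      have "B powr p * (\<Sum>m\<in>F. cmod (a m) powr p) \<le> B powr p * ell_norm p a powr p"
        by (intro mult_left_mono sum_powr_le_ell_norm p a that) auto
      then show ?thesis using bd[OF that S] B by (simp add: powr_mult ell_norm_nonneg)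
    qed
    then show "\<forall>\<^sub>F F in finite_subsets_at_top UNIV.
        (\<Sum>n\<in>S. cmod (\<Sum>m\<in>F. complex_of_real (K (n - m)) * a m) powr p) \<le> (B * ell_norm p a) powr p"
      by (intro eventually_finite_subsets_at_top_weakI)
  qed simp
qed

text \<open>Young's inequality with the exact constant \<open>ell_norm 1 K\<close>, which the final
  norm estimate with \<open>D\<close> requires.\<close>

lemma conv_ell_one_kernel:
  assumes p: "1 \<le> p" and K: "K \<in> ell 1" and a: "a \<in> ell p"
  shows "conv K a \<in> ell p \<and> ell_norm p (conv K a) \<le> ell_norm 1 K * ell_norm p a"
proof (rule conv_ell_of_finite[OF p ell_norm_nonneg a convolvable_ell_one_kernel[OF p K a]])
  fix F S :: "int set"
  assume fin: "finite F" "finite S"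
  have "cmod (\<Sum>m\<in>F. complex_of_real (K (n - m)) * a m) \<le> (\<Sum>m\<in>F. \<bar>K (n - m)\<bar> * cmod (a m))" for n
    by (rule order_trans[OF norm_sum]) (simp add: norm_mult)
  then have "(\<Sum>n\<in>S. cmod (\<Sum>m\<in>F. complex_of_real (K (n - m)) * a m) powr p)
      \<le> (\<Sum>n\<in>S. (\<Sum>m\<in>F. \<bar>K (n - m)\<bar> * cmod (a m)) powr p)"
    using p by (intro sum_mono powr_mono2) auto
  also have "\<dots> \<le> ell_norm 1 K powr p * (\<Sum>m\<in>F. cmod (a m) powr p)"
    by (intro young_convolution_finite p K fin) auto
  finally show "(\<Sum>n\<in>S. cmod (\<Sum>m\<in>F. complex_of_real (K (n - m)) * a m) powr p)
      \<le> ell_norm 1 K powr p * (\<Sum>m\<in>F. cmod (a m) powr p)" .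
qed

section \<open>The Riesz-Titchmarsh transform\<close>

text \<open>Passes from complex to real sequences; the factor \<open>1 / pi\<close> is below 1 and
  is given away here.\<close>

lemma cmod_finite_H_plus_le:
  "cmod (\<Sum>m\<in>F. complex_of_real (K_Hplus (n - m)) * a m)
    \<le> \<bar>fconv cauchy_kernel F (\<lambda>m. Re (a m)) n\<bar> + \<bar>fconv cauchy_kernel F (\<lambda>m. Im (a m)) n\<bar>"
proof -
  let ?z = "\<Sum>m\<in>F. complex_of_real (cauchy_kernel (n - m)) * a m"
  have "(\<Sum>m\<in>F. complex_of_real (K_Hplus (n - m)) * a m) = ?z / complex_of_real pi"
    by (simp add: K_Hplus_eq sum_divide_distrib)
  then have "cmod (\<Sum>m\<in>F. complex_of_real (K_Hplus (n - m)) * a m) = cmod ?z / pi"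
    by (simp add: norm_divide)
  also have "\<dots> \<le> cmod ?z / 1" using pi_ge_two by (intro divide_left_mono) auto
  also have "\<dots> \<le> \<bar>Re ?z\<bar> + \<bar>Im ?z\<bar>" using cmod_le[of ?z] by simp
  finally show ?thesis by (simp add: fconv_def)
qed

lemma H_plus_bounded:
  assumes p: "1 < p"
  shows "bounded_on_ell p H_plus"
proof -
  obtain A where A: "0 \<le> A" and bound: "\<And>F S a. finite F \<Longrightarrow> finite S \<Longrightarrow>
     (\<Sum>n\<in>S. \<bar>fconv cauchy_kernel F a n\<bar> powr p) \<le> A * (\<Sum>m\<in>F. \<bar>a m\<bar> powr p)"
    using fconv_cauchy_kernel_bounded[OF p] unfolding fconv_bounded_def by auto
  \<comment> \<open>\<open>2 powr p\<close> is the cost of adding two terms, and \<open>A\<close>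
    occurs once for the real and once for the imaginary part.\<close>
  define B where "B = (2 powr p * (A + A)) powr (1 / p)"
  have Bp: "B powr p = 2 powr p * (A + A)" using p A by (simp add: B_def powr_powr)
  have B: "0 \<le> B" by (simp add: B_def)
  show ?thesis
    unfolding bounded_on_ell_def
  proof (intro exI[of _ B] ballI)
    fix a :: "int \<Rightarrow> complex"
    assume a: "a \<in> ell p"
    show "H_plus a \<in> ell p \<and> ell_norm p (H_plus a) \<le> B * ell_norm p a"
      unfolding H_plus_def
    proof (rule conv_ell_of_finite[OF _ _ a])
      fix F S :: "int set"
      assume fin: "finite F" "finite S"
      let ?u = "\<lambda>n. \<bar>fconv cauchy_kernel F (\<lambda>m. Re (a m)) n\<bar>"
      let ?v = "\<lambda>n. \<bar>fconv cauchy_kernel F (\<lambda>m. Im (a m)) n\<bar>"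
      have "cmod (\<Sum>m\<in>F. complex_of_real (K_Hplus (n - m)) * a m) powr p
          \<le> 2 powr p * (?u n powr p + ?v n powr p)" for n
      proof -
        have "cmod (\<Sum>m\<in>F. complex_of_real (K_Hplus (n - m)) * a m) powr p \<le> (?u n + ?v n) powr p"
          using p by (intro powr_mono2 cmod_finite_H_plus_le) auto
        also have "\<dots> \<le> 2 powr p * (?u n powr p + ?v n powr p)"
          using p by (intro powr_add_le) auto
        finally show ?thesis .
      qed
      then have "(\<Sum>n\<in>S. cmod (\<Sum>m\<in>F. complex_of_real (K_Hplus (n - m)) * a m) powr p)
          \<le> (\<Sum>n\<in>S. 2 powr p * (?u n powr p + ?v n powr p))" by (intro sum_mono)
      also have "\<dots> = 2 powr p * ((\<Sum>n\<in>S. ?u n powr p) + (\<Sum>n\<in>S. ?v n powr p))"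
        by (simp only: sum_distrib_left[symmetric] sum.distrib)
      also have "\<dots> \<le> 2 powr p * (A * (\<Sum>m\<in>F. cmod (a m) powr p) + A * (\<Sum>m\<in>F. cmod (a m) powr p))"
      proof (intro mult_left_mono add_mono)
        show "(\<Sum>n\<in>S. ?u n powr p) \<le> A * (\<Sum>m\<in>F. cmod (a m) powr p)"
          using p A abs_Re_le_cmod
          by (intro order_trans[OF bound[OF fin]] mult_left_mono sum_mono powr_mono2) auto
        show "(\<Sum>n\<in>S. ?v n powr p) \<le> A * (\<Sum>m\<in>F. cmod (a m) powr p)"
          using p A abs_Im_le_cmod
          by (intro order_trans[OF bound[OF fin]] mult_left_mono sum_mono powr_mono2) auto
      qed auto
      finally show "(\<Sum>n\<in>S. cmod (\<Sum>m\<in>F. complex_of_real (K_Hplus (n - m)) * a m) powr p)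
          \<le> B powr p * (\<Sum>m\<in>F. cmod (a m) powr p)"
        unfolding Bp by (simp only: distrib_right mult.assoc)
    qed (use p B convolvable_K_Hplus[OF _ a] in auto)
  qed
qed

text \<open>Real and imaginary part are each tested at height \<open>t / 2\<close> with constant 8,
  which gives twice 16.\<close>

lemma card_finite_H_plus:
  fixes t :: real
  assumes fin: "finite F" "finite S" and t: "0 < t"
    and gt: "\<And>n. n \<in> S \<Longrightarrow> t < cmod (\<Sum>m\<in>F. complex_of_real (K_Hplus (n - m)) * a m)"
  shows "card S * t \<le> 32 * (\<Sum>m\<in>F. cmod (a m))"
proof -
  let ?T = "\<lambda>b. {n\<in>S. t / 2 < \<bar>fconv cauchy_kernel F b n\<bar>}"
  have bd: "card (?T b) * (t / 2) \<le> 8 * (\<Sum>m\<in>F. cmod (a m))" if "\<And>m. \<bar>b m\<bar> \<le> cmod (a m)" for b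
  proof -
    have "card (?T b) * (t / 2) \<le> 8 * (\<Sum>m\<in>F. \<bar>b m\<bar>)"
      using fin t by (intro card_fconv_cauchy_kernel) auto
    also have "\<dots> \<le> 8 * (\<Sum>m\<in>F. cmod (a m))"
      using that by (intro mult_left_mono sum_mono) auto
    finally show ?thesis .
  qed
  have "n \<in> ?T (\<lambda>m. Re (a m)) \<union> ?T (\<lambda>m. Im (a m))" if "n \<in> S" for n
    using gt[OF that] cmod_finite_H_plus_le[where n = n and F = F and a = a] that by auto
  then have "card S \<le> card (?T (\<lambda>m. Re (a m)) \<union> ?T (\<lambda>m. Im (a m)))"
    using fin by (intro card_mono) auto
  also have "\<dots> \<le> card (?T (\<lambda>m. Re (a m))) + card (?T (\<lambda>m. Im (a m)))" by (rule card_Un_le)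
  finally have "real (card S) * t \<le> real \<dots> * t" using t by (intro mult_right_mono) auto
  then show ?thesis
    using bd[of "\<lambda>m. Re (a m)"] bd[of "\<lambda>m. Im (a m)"] abs_Re_le_cmod abs_Im_le_cmod
    by (simp add: algebra_simps)
qed

text \<open>The strict inequalities at the finitely many points of \<open>S\<close> are open
  conditions, so a single finite truncation satisfies all of them at once.\<close>

lemma card_H_plus:
  fixes t :: real
  assumes a: "a \<in> ell 1" and S: "finite S" and t: "0 < t" and gt: "\<And>n. n \<in> S \<Longrightarrow> t < cmod (H_plus a n)"
  shows "card S * t \<le> 32 * ell_norm 1 a"
proof -
  have conv: "convolvable K_Hplus a" by (rule convolvable_K_Hplus[OF _ a]) simp
  have "\<forall>\<^sub>F F in finite_subsets_at_top UNIV. t < cmod (\<Sum>m\<in>F. complex_of_real (K_Hplus (n - m)) * a m)"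
    if "n \<in> S" for n
    using gt[OF that] unfolding H_plus_def
    by (rule order_tendstoD(1)[OF tendsto_norm[OF convolvable_tendsto[OF conv]]])
  then have "\<forall>\<^sub>F F in finite_subsets_at_top UNIV.
      \<forall>n\<in>S. t < cmod (\<Sum>m\<in>F. complex_of_real (K_Hplus (n - m)) * a m)"
    by (intro eventually_ball_finite S ballI)
  then obtain F where F: "finite F"
      "\<And>n. n \<in> S \<Longrightarrow> t < cmod (\<Sum>m\<in>F. complex_of_real (K_Hplus (n - m)) * a m)"
    unfolding eventually_finite_subsets_at_top by (metis order_refl)
  have "card S * t \<le> 32 * (\<Sum>m\<in>F. cmod (a m))"
    by (rule card_finite_H_plus[OF F(1) S t F(2)])
  also have "\<dots> \<le> 32 * ell_norm 1 a"
    using sum_norm_le_ell_norm_one[OF a F(1)] by simp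
  finally show ?thesis .
qed

section \<open>The discrete Hilbert transform\<close>

lemma K_d_eq: "K_d n = K_Hplus n + D n"
  by (simp add: D_def)

lemma convolvable_K_d:
  assumes "1 \<le> p" "a \<in> ell p"
  shows "convolvable K_d a"
  using convolvable_K_Hplus[OF assms] convolvable_ell_one_kernel[OF assms(1) D_ell_one assms(2)]
  unfolding convolvable_def K_d_eq of_real_add distrib_right by (auto intro: summable_on_add)

lemma H_d_eq:
  assumes "1 \<le> p" "a \<in> ell p"
  shows "H_d a = (\<lambda>n. H_plus a n + conv D a n)"
  using convolvable_K_Hplus[OF assms] convolvable_ell_one_kernel[OF assms(1) D_ell_one assms(2)]
  unfolding convolvable_def H_d_def H_plus_def conv_def K_d_eq of_real_add distrib_right
  by (intro ext infsum_add) auto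

text \<open>The level is halved between \<open>H_plus a\<close> and \<open>conv D a\<close>, which
  doubles both constants 32 and \<open>ell_norm 1 D\<close>.\<close>

lemma card_H_d:
  fixes t :: real
  assumes a: "a \<in> ell 1" and t: "0 < t"
  shows "finite {n. cmod (H_d a n) > t} \<and>
    card {n. cmod (H_d a n) > t} \<le> (64 + 2 * ell_norm 1 D) * ell_norm 1 a / t"
proof (rule card_le_of_finite_subsets[OF t])
  fix S :: "int set"
  assume S: "finite S" and sub: "S \<subseteq> {n. cmod (H_d a n) > t}"
  let ?S1 = "{n\<in>S. t / 2 < cmod (H_plus a n)}" and ?S2 = "{n\<in>S. t / 2 < cmod (conv D a n)}"
  have "n \<in> ?S1 \<union> ?S2" if "n \<in> S" for n
  proof -
    have "t < cmod (H_plus a n + conv D a n)" using sub that H_d_eq[OF _ a] by auto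
    also have "\<dots> \<le> cmod (H_plus a n) + cmod (conv D a n)" by (rule norm_triangle_ineq)
    finally show ?thesis using that by auto
  qed
  then have "card S \<le> card (?S1 \<union> ?S2)" using S by (intro card_mono) auto
  also have "\<dots> \<le> card ?S1 + card ?S2" by (rule card_Un_le)
  finally have card: "real (card S) * t \<le> real (card ?S1 + card ?S2) * t" using t by (intro mult_right_mono) auto
  have "card ?S1 * (t / 2) \<le> 32 * ell_norm 1 a"
    by (rule card_H_plus[OF a]) (use S t in auto)
  moreover have "card ?S2 * (t / 2) \<le> ell_norm 1 D * ell_norm 1 a"
  proof -
    have D: "conv D a \<in> ell 1 \<and> ell_norm 1 (conv D a) \<le> ell_norm 1 D * ell_norm 1 a"
      by (intro conv_ell_one_kernel D_ell_one a) simp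
    \<comment> \<open>Chebyshev's inequality for the summable sequence
      \<open>conv D a\<close>.\<close>
    have "card ?S2 * (t / 2) = (\<Sum>n\<in>?S2. t / 2)" by simp
    also have "\<dots> \<le> (\<Sum>n\<in>?S2. cmod (conv D a n))" by (intro sum_mono) auto
    also have "\<dots> \<le> ell_norm 1 (conv D a)"
      using S D by (intro sum_norm_le_ell_norm_one) auto
    finally show ?thesis using D by linarith
  qed
  ultimately show "card S * t \<le> (64 + 2 * ell_norm 1 D) * ell_norm 1 a"
    using card by (simp add: algebra_simps)
qed

lemma H_d_ell:
  assumes p: "1 < p" and a: "a \<in> ell p"
  shows "H_d a \<in> ell p" "H_plus a \<in> ell p"
    "ell_norm p (H_d a) \<le> ell_norm p (H_plus a) + ell_norm 1 D * ell_norm p a"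
proof -
  have p1: "1 \<le> p" using p by simp
  obtain B where B: "\<And>a. a \<in> ell p \<Longrightarrow> H_plus a \<in> ell p \<and> ell_norm p (H_plus a) \<le> B * ell_norm p a"
    using H_plus_bounded[OF p] unfolding bounded_on_ell_def by blast
  show H: "H_plus a \<in> ell p" using B[OF a] by (rule conjunct1)
  have D: "conv D a \<in> ell p \<and> ell_norm p (conv D a) \<le> ell_norm 1 D * ell_norm p a"
    by (rule conv_ell_one_kernel[OF p1 D_ell_one a])
  with minkowski_ell[OF p1 H, of "conv D a"] show "H_d a \<in> ell p"
    "ell_norm p (H_d a) \<le> ell_norm p (H_plus a) + ell_norm 1 D * ell_norm p a"
    by (auto simp: H_d_eq[OF p1 a])
qed

lemma H_d_bounded:
  assumes p: "1 < p"
  shows "bounded_on_ell p H_d"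
proof -
  obtain B where B: "\<And>a. a \<in> ell p \<Longrightarrow> H_plus a \<in> ell p \<and> ell_norm p (H_plus a) \<le> B * ell_norm p a"
    using H_plus_bounded[OF p] unfolding bounded_on_ell_def by blast
  have "H_d a \<in> ell p \<and> ell_norm p (H_d a) \<le> (B + ell_norm 1 D) * ell_norm p a" if "a \<in> ell p" for a
    using H_d_ell[OF p that] B[OF that] by (simp add: distrib_right)
  then show ?thesis unfolding bounded_on_ell_def by blast
qed

theorem proposition4p3:
  shows
    "D \<in> ell 1 \<and>
     (\<forall>p::real. 1 \<le> p \<longrightarrow>
        (\<forall>a \<in> ell p. convolvable K_d a \<and> convolvable K_Hplus a)) \<and>
     (\<forall>p::real. 1 < p \<longrightarrow>
        (\<forall>a \<in> ell p. H_d a \<in> ell p \<and> H_plus a \<in> ell p \<and>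
           ell_norm p (H_d a) \<le> ell_norm p (H_plus a) + ell_norm 1 D * ell_norm p a)) \<and>
     (\<exists>C::real. \<forall>a \<in> ell 1. \<forall>t>0.
        finite {n. cmod (H_d a n) > t} \<and>
        real (card {n. cmod (H_d a n) > t})
          \<le> C * ell_norm 1 a / t + ell_norm 1 D * ell_norm 1 a / t) \<and>
     weak_type_1_1 H_d \<and>
     (\<forall>p::real. 1 < p \<longrightarrow> bounded_on_ell p H_d)"
proof (intro conjI)
  show "\<exists>C::real. \<forall>a \<in> ell 1. \<forall>t>0.
        finite {n. cmod (H_d a n) > t} \<and>
        real (card {n. cmod (H_d a n) > t})
          \<le> C * ell_norm 1 a / t + ell_norm 1 D * ell_norm 1 a / t"
  \<comment> \<open>Halving the level produced the norm of \<open>D\<close> twice. One copy goes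
    into the constant, which may depend on the fixed kernel \<open>D\<close>; the other is the
    separate term of the claim.\<close>
  proof (intro exI[of _ "64 + ell_norm 1 D"] ballI allI impI)
    fix a :: "int \<Rightarrow> complex" and t :: real
    assume "a \<in> ell 1" "0 < t"
    moreover have "(64 + 2 * ell_norm 1 D) * ell_norm 1 a / t
        = (64 + ell_norm 1 D) * ell_norm 1 a / t + ell_norm 1 D * ell_norm 1 a / t"
      unfolding add_divide_distrib[symmetric] by (simp add: algebra_simps)
    ultimately show "finite {n. cmod (H_d a n) > t} \<and>
        real (card {n. cmod (H_d a n) > t})
          \<le> (64 + ell_norm 1 D) * ell_norm 1 a / t + ell_norm 1 D * ell_norm 1 a / t"
      using card_H_d[of a t] by (simp only:)
  qed
  show "weak_type_1_1 H_d"
    unfolding weak_type_1_1_def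
    by (intro exI[of _ "64 + 2 * ell_norm 1 D"] ballI allI impI card_H_d)
  show "D \<in> ell 1" by (rule D_ell_one)
  show "\<forall>p::real. 1 \<le> p \<longrightarrow> (\<forall>a \<in> ell p. convolvable K_d a \<and> convolvable K_Hplus a)"
    by (intro allI impI ballI conjI convolvable_K_d convolvable_K_Hplus)
  show "\<forall>p::real. 1 < p \<longrightarrow> (\<forall>a \<in> ell p. H_d a \<in> ell p \<and> H_plus a \<in> ell p \<and>
      ell_norm p (H_d a) \<le> ell_norm p (H_plus a) + ell_norm 1 D * ell_norm p a)"
    by (intro allI impI ballI conjI H_d_ell)
  show "\<forall>p::real. 1 < p \<longrightarrow> bounded_on_ell p H_d"
    by (intro allI impI H_d_bounded)
qed

end
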